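(* Let $\alpha,\beta\in[0,1)$ with not both $\alpha$ and $\beta$ in $\{0,\frac12\}$, and let $N\ge1$. Then $\sigma(\mathcal{L}_N^{(\alpha,\beta)})=S_1\sqcup S_2\sqcup S_3$ (pairwise disjoint union), where $S_1=\{\lambda\in\mathbb R\setminus\mathcal E(\alpha,\beta): R(\alpha,\beta,\lambda)\in\sigma(\mathcal{L}_{N-1}^{(\alpha_\downarrow(\alpha,\beta,\lambda),\beta_\downarrow(\alpha,\beta,\lambda))})\}$, $S_2=\{\lambda\in\mathbb R:\mathcal D(\beta,\lambda)=0 \text{ and } \lambda \text{ is an eigenvalue of } \mathcal{L}_N^{(\alpha,\beta)}\}$, $S_3=\{\frac32\}$ if $\alpha=0$, $S_3=\{\frac12\}$ if $\alpha=\frac12$, and $S_3=\emptyset$ otherwise. Moreover, each $\lambda\in S_1$ has multiplicity $\mathrm{mult}(\mathcal{L}_{N-1}^{(\alpha_\downarrow(\alpha,\beta,\lambda),\beta_\downarrow(\alpha,\beta,\lambda))},R(\alpha,\beta,\lambda))$ in $\sigma(\mathcal{L}_N^{(\alpha,\beta)})$, and $\lambda\in S_3$ has multiplicity $\frac{3^N+3}{2}$.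
   Context: Sierpinski gasket graphs: let $x_0=(0,0)$, $x_1=(\frac12,\frac{\sqrt3}{2})$, $x_2=(1,0)$, $\Phi_i(x)=\frac12(x-x_i)+x_i$; $\mathfrak G_0$ is the complete graph on $\{x_0,x_1,x_2\}$, $\mathfrak G_N=\bigcup_{i}\Phi_i(\mathfrak G_{N-1})$, $G_N=2^N\mathfrak G_N$ with vertex set $V_N$ (edges of length 1, $G_{N-1}\subset G_N$, $|V_N|=\frac{3^{N+1}+3}{2}$), a subgraph of the triangular lattice $\mathbb T$. A unitary connection assigns to each oriented edge $xy$ a unit complex number $\omega_{xy}$ with $\omega_{yx}=\overline{\omega_{xy}}$. For $\alpha,\beta\in[0,1)$, $\mathcal{L}_N^{(\alpha,\beta)}u(x)=\sum_{y\sim x}\frac{1}{\deg_{G_N}(x)}(u(x)-\omega_{xy}u(y))$ on $L^2(V_N,\deg_{G_N})$, where $\omega$ is the restriction to $G_N$ of a unitary connection on $\mathbb T$ with holonomy $e^{2\pi i\alpha}$ around every upward unit triangle and $e^{2\pi i\beta}$ around every downward unit triangle (both traversed counterclockwise); unique up to gauge. $\sigma$ denotes the spectrum (eigenvalues) and $\mathrm{mult}(\mathcal L,\lambda)$ the multiplicity ($0$ if $\lambda\notin\sigma(\mathcal L)$). Functions: $A(\alpha,\beta,\lambda)=16\lambda^2-(32+4\cos2\pi\alpha)\lambda+15+4\cos2\pi\alpha+\cos(2\pi(\alpha+\beta))$; $\mathcal D(\beta,\lambda)=-\lambda^3+3\lambda^2-\frac{45}{16}\lambda+\frac{13}{16}-\frac1{32}\cos2\pi\beta$;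 $\Psi(\alpha,\beta,\lambda)=(1-\lambda)^2-\frac1{16}+\frac{1-\lambda}{4}(2e^{-2\pi i\alpha}+e^{-2\pi i(2\alpha+\beta)})+\frac1{16}(e^{-4\pi i\alpha}+2e^{-2\pi i(\alpha+\beta)})$; $R(\alpha,\beta,\lambda)=1+\frac{A(\alpha,\beta,\lambda)-64\mathcal D(\beta,\lambda)(1-\lambda)}{16|\Psi(\alpha,\beta,\lambda)|}$; $\theta(\alpha,\beta,\lambda)=\frac{\arg\Psi(\alpha,\beta,\lambda)}{2\pi}$ with $\arg\in[0,2\pi)$; $\alpha_\downarrow=3\alpha+\beta+3\theta \pmod 1$; $\beta_\downarrow=3\beta+\alpha-3\theta\pmod 1$; exceptional set $\mathcal E(\alpha,\beta)=\{\lambda\in\mathbb R:\Psi(\alpha,\beta,\lambda)=0\text{ or }\mathcal D(\beta,\lambda)=0\}$. *)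

theory Defs
  imports "HOL-Analysis.Analysis" "HOL-Library.Function_Algebras"
begin

(* Points of the triangular lattice T: (a,b) :: int * int stands for a*e1 + b*e2,
   e1 = (1,0), e2 = (1/2, sqrt 3 / 2).  Thus x0 = (0,0), x2 = e1 = (1,0), x1 = e2 = (0,1). *)
type_synonym pt = "int \<times> int"

definition shift :: "pt \<Rightarrow> pt \<Rightarrow> pt" where
  "shift s x = (fst x + fst s, snd x + snd s)"

fun sg_edges :: "nat \<Rightarrow> (pt \<times> pt) set" where
  "sg_edges 0 = {(x, y). x \<in> {(0,0),(1,0),(0,1)} \<and> y \<in> {(0,0),(1,0),(0,1)} \<and> x \<noteq> y}"
| "sg_edges (Suc n) =
     (\<Union>s\<in>{(0,0), (0, 2^n), (2^n, 0)}. (\<lambda>(x, y). (shift s x, shift s y)) ` sg_edges n)"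

fun sg_verts :: "nat \<Rightarrow> pt set" where
  "sg_verts 0 = {(0,0),(1,0),(0,1)}"
| "sg_verts (Suc n) = (\<Union>s\<in>{(0,0), (0, 2^n), (2^n, 0)}. shift s ` sg_verts n)"

definition sg_nbrs :: "nat \<Rightarrow> pt \<Rightarrow> pt set" where
  "sg_nbrs N x = {y. (x, y) \<in> sg_edges N}"

definition sg_deg :: "nat \<Rightarrow> pt \<Rightarrow> nat" where
  "sg_deg N x = card (sg_nbrs N x)"

definition lat_adj :: "pt \<Rightarrow> pt \<Rightarrow> bool" where
  "lat_adj x y \<longleftrightarrow> (fst y - fst x, snd y - snd x) \<in> {(1,0),(-1,0),(0,1),(0,-1),(-1,1),(1,-1)}"

definition unitary_connection :: "(pt \<Rightarrow> pt \<Rightarrow> complex) \<Rightarrow> bool" where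
  "unitary_connection \<omega> \<longleftrightarrow>
     (\<forall>x y. lat_adj x y \<longrightarrow> cmod (\<omega> x y) = 1 \<and> \<omega> y x = cnj (\<omega> x y))"

(* holonomy e^{2 pi i alpha} around every upward triangle p, p+e1, p+e2 and
   e^{2 pi i beta} around every downward triangle p+e1, p+e1+e2, p+e2,
   both traversed counterclockwise; holonomy of a closed path = product of omega_{xy} along it *)
definition has_holonomy :: "(pt \<Rightarrow> pt \<Rightarrow> complex) \<Rightarrow> real \<Rightarrow> real \<Rightarrow> bool" where
  "has_holonomy \<omega> \<alpha> \<beta> \<longleftrightarrow>
     (\<forall>a b. \<omega> (a,b) (a+1,b) * \<omega> (a+1,b) (a,b+1) * \<omega> (a,b+1) (a,b) = cis (2*pi*\<alpha>)) \<and>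
     (\<forall>a b. \<omega> (a+1,b) (a+1,b+1) * \<omega> (a+1,b+1) (a,b+1) * \<omega> (a,b+1) (a+1,b) = cis (2*pi*\<beta>))"

(* a connection with the prescribed holonomies (unique up to gauge; the spectral data are gauge invariant) *)
definition mag_conn :: "real \<Rightarrow> real \<Rightarrow> pt \<Rightarrow> pt \<Rightarrow> complex" where
  "mag_conn \<alpha> \<beta> = (SOME \<omega>. unitary_connection \<omega> \<and> has_holonomy \<omega> \<alpha> \<beta>)"

definition mag_lap :: "nat \<Rightarrow> real \<Rightarrow> real \<Rightarrow> (pt \<Rightarrow> complex) \<Rightarrow> pt \<Rightarrow> complex" where
  "mag_lap N \<alpha> \<beta> u x =
     (\<Sum>y\<in>sg_nbrs N x. (u x - mag_conn \<alpha> \<beta> x y * u y) / of_nat (sg_deg N x))"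

definition eigenspace_L :: "nat \<Rightarrow> real \<Rightarrow> real \<Rightarrow> real \<Rightarrow> (pt \<Rightarrow> complex) set" where
  "eigenspace_L N \<alpha> \<beta> lam =
     {u. (\<forall>x. x \<notin> sg_verts N \<longrightarrow> u x = 0) \<and>
         (\<forall>x\<in>sg_verts N. mag_lap N \<alpha> \<beta> u x = complex_of_real lam * u x)}"

(* spectrum (set of eigenvalues; the operator is self-adjoint, so they are real) *)
definition spec_L :: "nat \<Rightarrow> real \<Rightarrow> real \<Rightarrow> real set" where
  "spec_L N \<alpha> \<beta> = {lam. \<exists>u\<in>eigenspace_L N \<alpha> \<beta> lam. u \<noteq> (\<lambda>_. 0)}"

definition mult_L :: "nat \<Rightarrow> real \<Rightarrow> real \<Rightarrow> real \<Rightarrow> nat" where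
  "mult_L N \<alpha> \<beta> lam = vector_space.dim (\<lambda>(c::complex) u x. c * u x) (eigenspace_L N \<alpha> \<beta> lam)"

definition A_fn :: "real \<Rightarrow> real \<Rightarrow> real \<Rightarrow> real" where
  "A_fn \<alpha> \<beta> lam = 16*lam^2 - (32 + 4*cos(2*pi*\<alpha>))*lam + 15 + 4*cos(2*pi*\<alpha>) + cos(2*pi*(\<alpha>+\<beta>))"

definition D_fn :: "real \<Rightarrow> real \<Rightarrow> real" where
  "D_fn \<beta> lam = - (lam^3) + 3*lam^2 - 45/16*lam + 13/16 - 1/32*cos(2*pi*\<beta>)"

definition Psi_fn :: "real \<Rightarrow> real \<Rightarrow> real \<Rightarrow> complex" where
  "Psi_fn \<alpha> \<beta> lam = complex_of_real ((1-lam)^2 - 1/16)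
     + complex_of_real ((1-lam)/4) * (2 * cis (-2*pi*\<alpha>) + cis (-2*pi*(2*\<alpha>+\<beta>)))
     + 1/16 * (cis (-4*pi*\<alpha>) + 2 * cis (-2*pi*(\<alpha>+\<beta>)))"

definition R_fn :: "real \<Rightarrow> real \<Rightarrow> real \<Rightarrow> real" where
  "R_fn \<alpha> \<beta> lam = 1 + (A_fn \<alpha> \<beta> lam - 64 * D_fn \<beta> lam * (1-lam)) / (16 * cmod (Psi_fn \<alpha> \<beta> lam))"

definition arg02pi :: "complex \<Rightarrow> real" where
  "arg02pi z = (if Arg z < 0 then Arg z + 2*pi else Arg z)"

definition theta_fn :: "real \<Rightarrow> real \<Rightarrow> real \<Rightarrow> real" where
  "theta_fn \<alpha> \<beta> lam = arg02pi (Psi_fn \<alpha> \<beta> lam) / (2*pi)"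

definition alpha_down :: "real \<Rightarrow> real \<Rightarrow> real \<Rightarrow> real" where
  "alpha_down \<alpha> \<beta> lam = frac (3*\<alpha> + \<beta> + 3 * theta_fn \<alpha> \<beta> lam)"

definition beta_down :: "real \<Rightarrow> real \<Rightarrow> real \<Rightarrow> real" where
  "beta_down \<alpha> \<beta> lam = frac (3*\<beta> + \<alpha> - 3 * theta_fn \<alpha> \<beta> lam)"

definition exc_set :: "real \<Rightarrow> real \<Rightarrow> real set" where
  "exc_set \<alpha> \<beta> = {lam. Psi_fn \<alpha> \<beta> lam = 0 \<or> D_fn \<beta> lam = 0}"

end

theory Submission
  imports Defs
begin

text \<open>
  An eigenfunction on \<open>G_N\<close> is determined by its restriction to the doubled copy of \<open>V_(N-1)\<close> unless
  \<open>D_fn\<close> vanishes: the three midpoints of each cell of side 2 see only that cell, and their equations can be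
  solved by Cramer's rule. After the elimination, every corner equation is again a magnetic eigenvalue equation on
  \<open>G_(N-1)\<close>. Its weights are \<open>Psi_fn\<close> times the old parallel transport along doubled edges, so
  normalising by \<open>cmod Psi_fn\<close> gives a unitary connection. Its holonomy around an upward triangle collects
  three upward triangles, one downward triangle and three phases of \<open>Psi_fn\<close>, and symmetrically for
  downward triangles. Connections with equal holonomies on the simply connected lattice are gauge equivalent, so this is
  the connection with parameters \<open>alpha_down\<close>, \<open>beta_down\<close>. If \<open>Psi_fn\<close> vanishes, the corner
  equations decouple: either all corner values are free, which gives the dimension \<open>card V_(N-1)\<close>, or all vanish.
\<close>

section \<open>The cells of the gasket graph\<close>

text \<open>An upward unit triangle is recorded by its lower left corner, so that vertices, edges
  and degrees all become membership questions about one set of points.\<close>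

fun sg_cells :: "nat \<Rightarrow> pt set" where
  "sg_cells 0 = {(0,0)}"
| "sg_cells (Suc n) = (\<Union>s\<in>{(0,0), (0, 2^n), (2^n, 0)}. shift s ` sg_cells n)"

declare sg_cells.simps(2) [simp del] sg_verts.simps(2) [simp del] sg_edges.simps(2) [simp del]

definition up_tri :: "pt \<Rightarrow> pt set" where
  "up_tri c = {c, (fst c + 1, snd c), (fst c, snd c + 1)}"

lemma up_tri_mem_iff: "(i,j) \<in> up_tri c \<longleftrightarrow> c \<in> {(i,j), (i-1,j), (i,j-1)}"
  by (cases c) (auto simp: up_tri_def)

lemma image_distinct_pairs:
  assumes "inj f"
  shows "(\<lambda>(x, y). (f x, f y)) ` {(x, y). x \<in> A \<and> y \<in> A \<and> x \<noteq> y}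
    = {(x, y). x \<in> f ` A \<and> y \<in> f ` A \<and> x \<noteq> y}"
  using assms by (force simp: inj_eq)

lemma up_tri_shift: "shift s ` up_tri c = up_tri (shift s c)"
  by (auto simp: up_tri_def shift_def)

lemma shift_eq_iff [simp]: "shift s x = shift s y \<longleftrightarrow> x = y"
  by (auto simp: shift_def prod_eq_iff)

lemma sg_verts_cells: "sg_verts n = (\<Union>c\<in>sg_cells n. up_tri c)"
proof (induction n)
  case 0
  show ?case by (simp add: up_tri_def)
next
  case (Suc n)
  show ?case
    by (simp add: sg_cells.simps(2) sg_verts.simps(2) sg_edges.simps(2) Suc image_UN up_tri_shift)
qed

lemma sg_edges_cells:
  "sg_edges n = (\<Union>c\<in>sg_cells n. {(x, y). x \<in> up_tri c \<and> y \<in> up_tri c \<and> x \<noteq> y})"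
proof (induction n)
  case 0
  show ?case by (simp add: up_tri_def)
next
  case (Suc n)
  have *: "(\<lambda>(x, y). (shift s x, shift s y)) ` {(x, y). x \<in> up_tri c \<and> y \<in> up_tri c \<and> x \<noteq> y}
     = {(x, y). x \<in> up_tri (shift s c) \<and> y \<in> up_tri (shift s c) \<and> x \<noteq> y}" for s c
    unfolding up_tri_shift [symmetric] by (rule image_distinct_pairs) (simp add: inj_def)
  show ?case
    by (simp add: sg_cells.simps(2) sg_verts.simps(2) sg_edges.simps(2) Suc image_UN *)
qed

text \<open>The defining recursion glues three large copies, whereas decimation subdivides every
  smallest cell. Both agree because doubling turns a shift by \<open>2^n\<close> into a shift by
  \<open>2^Suc n\<close>.\<close>

lemma sg_cells_double:
  "sg_cells (Suc n) = (\<Union>(i,j)\<in>sg_cells n. {(2*i, 2*j), (2*i+1, 2*j), (2*i, 2*j+1)})"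
proof (induction n)
  case 0
  show ?case by (auto simp: shift_def sg_cells.simps(2))
next
  case (Suc n)
  have "sg_cells (Suc (Suc n)) = (\<Union>s\<in>{(0,0), (0, 2^Suc n), (2^Suc n, 0)}. shift s ` sg_cells (Suc n))"
    by (rule sg_cells.simps(2))
  also have "\<dots> = (\<Union>s\<in>{(0,0), (0, 2^n), (2^n, 0)}. \<Union>(i,j)\<in>shift s ` sg_cells n.
      {(2*i, 2*j), (2*i+1, 2*j), (2*i, 2*j+1)})"
    unfolding Suc image_UN by (simp add: shift_def algebra_simps split_beta)
  also have "\<dots> = (\<Union>(i,j)\<in>sg_cells (Suc n). {(2*i, 2*j), (2*i+1, 2*j), (2*i, 2*j+1)})"
    by (simp only: sg_cells.simps(2) UN_UN_flatten)
  finally show ?case .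
qed

text \<open>Parity locates a point inside its cell of side 2. A doubly odd point is the midpoint of
  a slanted side and never a lower left corner.\<close>

lemma sg_cells_Suc_iff:
  "(2*i, 2*j) \<in> sg_cells (Suc n) \<longleftrightarrow> (i,j) \<in> sg_cells n"
  "(2*i+1, 2*j) \<in> sg_cells (Suc n) \<longleftrightarrow> (i,j) \<in> sg_cells n"
  "(2*i, 2*j+1) \<in> sg_cells (Suc n) \<longleftrightarrow> (i,j) \<in> sg_cells n"
  "(2*i+1, 2*j+1) \<notin> sg_cells (Suc n)"
proof -
  have parity: "2*x \<noteq> 2*y+1" "2*y+1 \<noteq> 2*x" for x y :: int by presburger+
  show
    "(2*i, 2*j) \<in> sg_cells (Suc n) \<longleftrightarrow> (i,j) \<in> sg_cells n"
    "(2*i+1, 2*j) \<in> sg_cells (Suc n) \<longleftrightarrow> (i,j) \<in> sg_cells n"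
    "(2*i, 2*j+1) \<in> sg_cells (Suc n) \<longleftrightarrow> (i,j) \<in> sg_cells n"
    "(2*i+1, 2*j+1) \<notin> sg_cells (Suc n)"
    unfolding sg_cells_double by (auto simp: parity)
qed

lemma sg_cells_Suc_pred_iff:
  "(2*i-1, 2*j) \<in> sg_cells (Suc n) \<longleftrightarrow> (i-1,j) \<in> sg_cells n"
  "(2*i, 2*j-1) \<in> sg_cells (Suc n) \<longleftrightarrow> (i,j-1) \<in> sg_cells n"
  "(2*i+1, 2*j-1) \<notin> sg_cells (Suc n)"
  "(2*i-1, 2*j+1) \<notin> sg_cells (Suc n)"
  using sg_cells_Suc_iff[of "i-1" j n] sg_cells_Suc_iff[of i "j-1" n]
  by (simp_all add: algebra_simps)

lemma sg_verts_iff: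
  "(i,j) \<in> sg_verts n \<longleftrightarrow> (i,j) \<in> sg_cells n \<or> (i-1,j) \<in> sg_cells n \<or> (i,j-1) \<in> sg_cells n"
  by (auto simp: sg_verts_cells up_tri_mem_iff)

lemma sg_verts_Suc_iff:
  "(2*i, 2*j) \<in> sg_verts (Suc n) \<longleftrightarrow> (i,j) \<in> sg_verts n"
  "(2*i+1, 2*j) \<in> sg_verts (Suc n) \<longleftrightarrow> (i,j) \<in> sg_cells n"
  "(2*i, 2*j+1) \<in> sg_verts (Suc n) \<longleftrightarrow> (i,j) \<in> sg_cells n"
  "(2*i+1, 2*j+1) \<in> sg_verts (Suc n) \<longleftrightarrow> (i,j) \<in> sg_cells n"
    by (simp_all add: sg_verts_iff sg_cells_Suc_iff sg_cells_Suc_pred_iff)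

lemma finite_sg_cells: "finite (sg_cells n)"
  by (induction n) (auto simp: sg_cells.simps(2))

lemma finite_sg_verts: "finite (sg_verts n)"
  by (auto simp: sg_verts_cells finite_sg_cells up_tri_def)

lemma pt_parity_cases:
  fixes x :: pt
  obtains i j where "x = (2*i, 2*j)" | i j where "x = (2*i+1, 2*j)"
    | i j where "x = (2*i, 2*j+1)" | i j where "x = (2*i+1, 2*j+1)"
proof -
  have "\<exists>i. a = 2*i \<or> a = 2*i+1" for a :: int by presburger
  then show ?thesis using that by (cases x) metis
qed

section \<open>Counting cells and vertices\<close>

lemma card_image_Un:
  assumes "finite A" "finite B" "inj_on f A" "f ` A \<inter> B = {}"
  shows "card (f ` A \<union> B) = card A + card B"
  using assms by (simp add: card_Un_disjoint card_image)

lemma sg_cells_Suc_eq_images: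
  "sg_cells (Suc n) = (\<lambda>x::pt. (2 * fst x, 2 * snd x)) ` sg_cells n \<union>
     ((\<lambda>x::pt. (2 * fst x + 1, 2 * snd x)) ` sg_cells n \<union>
      (\<lambda>x::pt. (2 * fst x, 2 * snd x + 1)) ` sg_cells n)"
  unfolding sg_cells_double by (auto simp: split_beta)

lemma sg_verts_Suc_eq_images:
  "sg_verts (Suc n) = (\<lambda>x::pt. (2 * fst x, 2 * snd x)) ` sg_verts n \<union>
     ((\<lambda>x::pt. (2 * fst x + 1, 2 * snd x)) ` sg_cells n \<union>
      ((\<lambda>x::pt. (2 * fst x, 2 * snd x + 1)) ` sg_cells n \<union>
       (\<lambda>x::pt. (2 * fst x + 1, 2 * snd x + 1)) ` sg_cells n))" (is "_ = ?R")
proof (rule set_eqI)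
  fix x
  have parity: "2*x \<noteq> 2*y+1" "2*x+1 \<noteq> 2*y" for x y :: int by presburger+
  show "x \<in> sg_verts (Suc n) \<longleftrightarrow> x \<in> ?R"
    by (cases x rule: pt_parity_cases)
       (simp_all add: sg_verts_Suc_iff image_iff parity flip: ex_simps, force+)
qed

lemma card_sg_cells: "card (sg_cells n) = 3 ^ n"
proof (induction n)
  case 0
  show ?case by simp
next
  case (Suc n)
  have parity: "2*x \<noteq> 2*y+1" "2*x+1 \<noteq> 2*y" for x y :: int by presburger+
  have "card (sg_cells (Suc n)) = card (sg_cells n) + (card (sg_cells n) + card (sg_cells n))"
    unfolding sg_cells_Suc_eq_images
    by (subst card_image_Un card_image, auto simp: finite_sg_cells inj_on_def parity)+
  then show ?case using Suc by simp
qed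

text \<open>The old vertices survive as the even points and every cell contributes three midpoints.
  The factor 2 keeps the count in the naturals.\<close>

lemma card_sg_verts: "2 * card (sg_verts n) = 3 ^ Suc n + 3"
proof (induction n)
  case 0
  show ?case by simp
next
  case (Suc n)
  have parity: "2*x \<noteq> 2*y+1" "2*x+1 \<noteq> 2*y" for x y :: int by presburger+
  have "card (sg_verts (Suc n)) =
      card (sg_verts n) + (card (sg_cells n) + (card (sg_cells n) + card (sg_cells n)))"
    unfolding sg_verts_Suc_eq_images
    by (subst card_image_Un card_image, auto simp: finite_sg_cells finite_sg_verts inj_on_def parity)+
  then show ?case using Suc by (simp add: card_sg_cells)
qed

text \<open>The vertex can be the lower left, right or top corner of a cell. Cells meeting at it
  contribute disjoint pairs of neighbours, so sums split by cell.\<close>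

lemma sum_sg_nbrs:
  fixes f :: "pt \<Rightarrow> 'a::comm_monoid_add"
  shows "(\<Sum>y\<in>sg_nbrs n (i,j). f y) =
    (if (i,j) \<in> sg_cells n then f (i+1,j) + f (i,j+1) else 0) +
    (if (i-1,j) \<in> sg_cells n then f (i-1,j) + f (i-1,j+1) else 0) +
    (if (i,j-1) \<in> sg_cells n then f (i,j-1) + f (i+1,j-1) else 0)"
proof -
  have nb: "sg_nbrs n (i,j) =
    (if (i,j) \<in> sg_cells n then {(i+1,j), (i,j+1)} else {}) \<union>
    (if (i-1,j) \<in> sg_cells n then {(i-1,j), (i-1,j+1)} else {}) \<union>
    (if (i,j-1) \<in> sg_cells n then {(i,j-1), (i+1,j-1)} else {})"
    (is "?L = ?A \<union> ?B \<union> ?C")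
  proof (rule set_eqI)
    fix y
    have "y \<in> ?L \<longleftrightarrow> (\<exists>c\<in>sg_cells n. (i,j) \<in> up_tri c \<and> y \<in> up_tri c \<and> (i,j) \<noteq> y)"
      by (auto simp: sg_nbrs_def sg_edges_cells)
    also have "\<dots> \<longleftrightarrow> (\<exists>c\<in>{(i,j),(i-1,j),(i,j-1)}. c \<in> sg_cells n \<and> y \<in> up_tri c \<and> (i,j) \<noteq> y)"
      unfolding up_tri_mem_iff by blast
    also have "\<dots> \<longleftrightarrow> y \<in> ?A \<union> ?B \<union> ?C"
      by (auto simp: up_tri_def)
    finally show "y \<in> ?L \<longleftrightarrow> y \<in> ?A \<union> ?B \<union> ?C" .
  qed
  show ?thesis unfolding nb by (simp add: add_ac)
qed

lemma sg_deg_eq: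
  "sg_deg n (i,j) = 2 * (of_bool ((i,j) \<in> sg_cells n) + of_bool ((i-1,j) \<in> sg_cells n)
     + of_bool ((i,j-1) \<in> sg_cells n))"
  \<comment> \<open>The constant summand 1 turns the neighbour sum into a cardinality.\<close>
  using sum_sg_nbrs[of "\<lambda>_. 1::nat" n i j] by (auto simp: sg_deg_def)

lemma sg_deg_pos: "x \<in> sg_verts n \<Longrightarrow> sg_deg n x > 0"
  by (cases x) (auto simp: sg_deg_eq sg_verts_iff)

section \<open>Elimination of the midpoints of one cell\<close>

text \<open>
  A cell of side 2 has corners \<open>p0, p1, p2\<close> in counterclockwise order, and
  \<open>q0, q1, q2\<close> are the midpoints opposite to them. The three unit triangles at the corners have
  holonomy \<open>g\<close> and the inner triangle has holonomy \<open>h\<close>. All formulas below are stated at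
  one vertex and transported to the others by rotation.
\<close>

definition cell_conn :: "('v \<Rightarrow> 'v \<Rightarrow> complex) \<Rightarrow> complex \<Rightarrow> complex \<Rightarrow> 'v \<Rightarrow> 'v \<Rightarrow> 'v \<Rightarrow> 'v \<Rightarrow> 'v \<Rightarrow> 'v \<Rightarrow> bool"
  where "cell_conn w g h p0 p1 p2 q0 q1 q2 \<longleftrightarrow>
    (\<forall>(x,y)\<in>{(p0,q2),(q2,p1),(p1,q0),(q0,p2),(p2,q1),(q1,p0),(q0,q1),(q1,q2),(q2,q0)}. w x y * w y x = 1) \<and>
    w p0 q2 * w q2 q1 * w q1 p0 = g \<and> w p1 q0 * w q0 q2 * w q2 p1 = g \<and>
    w p2 q1 * w q1 q0 * w q0 p2 = g \<and> w q2 q0 * w q0 q1 * w q1 q2 = h"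

definition mid_eq :: "('v \<Rightarrow> 'v \<Rightarrow> complex) \<Rightarrow> complex
    \<Rightarrow> ('v \<Rightarrow> complex) \<Rightarrow> 'v \<Rightarrow> 'v \<Rightarrow> 'v \<Rightarrow> 'v \<Rightarrow> 'v \<Rightarrow> bool"
  where "mid_eq w M u q0 p1 p2 q1 q2 \<longleftrightarrow>
    M * u q0 = w q0 p1 * u p1 + w q0 p2 * u p2 + w q0 q1 * u q1 + w q0 q2 * u q2"

text \<open>
  With \<open>M = 4 * (1 - lam)\<close>, the midpoint equations form a 3-by-3 system whose determinant
  \<open>mid_det\<close> is \<open>64 * D_fn\<close> and whose right-hand side after multiplication by the adjugate is
  \<open>mid_val\<close>. Substituting the solution at a corner gives \<open>diag_coeff\<close>, which is
  \<open>2 * A_fn\<close>, and \<open>edge_coeff\<close>, which is \<open>16 * Psi_fn\<close> or its conjugate according to orientation.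
\<close>

definition mid_val :: "('v \<Rightarrow> 'v \<Rightarrow> complex) \<Rightarrow> complex \<Rightarrow> complex \<Rightarrow> complex \<Rightarrow> ('v \<Rightarrow> complex) \<Rightarrow> 'v \<Rightarrow> 'v \<Rightarrow> 'v \<Rightarrow> 'v \<Rightarrow> 'v \<Rightarrow> 'v \<Rightarrow> complex"
  where "mid_val w M h k u p0 p1 p2 q0 q1 q2 =
    (M^2 - 1) * (w q0 p1 * u p1 + w q0 p2 * u p2)
    + (M + h) * w q0 q2 * (w q2 p0 * u p0 + w q2 p1 * u p1)
    + (M + k) * w q0 q1 * (w q1 p2 * u p2 + w q1 p0 * u p0)"

definition mid_det :: "complex \<Rightarrow> complex \<Rightarrow> complex \<Rightarrow> complex" where
  "mid_det M h k = M^3 - 3*M - h - k"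

definition diag_coeff :: "complex \<Rightarrow> complex \<Rightarrow> complex \<Rightarrow> complex \<Rightarrow> complex \<Rightarrow> complex" where
  "diag_coeff M g g' h h' = 2 * (M^2 - 1) + (M + h) * g + (M + h') * g'"

definition edge_coeff :: "complex \<Rightarrow> complex \<Rightarrow> complex \<Rightarrow> complex" where
  "edge_coeff M g h = M^2 - 1 + 2*M*g + 2*g*h + M*h*g^2 + g^2"

lemma cell_conn_rotate:
  "cell_conn w g h p0 p1 p2 q0 q1 q2 \<Longrightarrow> cell_conn w g h p1 p2 p0 q1 q2 q0"
  by (auto simp: cell_conn_def mult_ac)

text \<open>Cramer's rule on a weighted triangle. The diagonal cofactor is \<open>M^2 - 1\<close>;
  an off-diagonal one adds the two-step path to the direct edge, and that path is the direct edge
  times \<open>h\<close> or its inverse \<open>k\<close>.\<close>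

lemma inner_triangle_solve:
  fixes M :: complex
  assumes inv: "w01 * w10 = 1" "w12 * w21 = 1" "w20 * w02 = 1" and h: "w20 * w01 * w12 = h" "h * k = 1"
    and E: "M * Q0 = R0 + w01 * Q1 + w02 * Q2" "M * Q1 = R1 + w12 * Q2 + w10 * Q0" "M * Q2 = R2 + w20 * Q0 + w21 * Q1"
  shows "(M^3 - 3*M - h - k) * Q0 = (M^2 - 1) * R0 + (M + h) * w02 * R2 + (M + k) * w01 * R1"
  using assms by algebra

text \<open>The Cramer vector solves the system. Keeping the determinant as a factor makes this a
  polynomial identity.\<close>

lemma inner_triangle_check:
  fixes M :: complex
  assumes inv: "w01 * w10 = 1" "w12 * w21 = 1" "w20 * w02 = 1" and h: "w20 * w01 * w12 = h" "h * k = 1"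
  shows "M * ((M^2 - 1) * R0 + (M + h) * w02 * R2 + (M + k) * w01 * R1) =
    (M^3 - 3*M - h - k) * R0 + w01 * ((M^2 - 1) * R1 + (M + h) * w10 * R0 + (M + k) * w12 * R2)
       + w02 * ((M^2 - 1) * R2 + (M + h) * w21 * R1 + (M + k) * w20 * R0)"
  using assms by algebra

lemma mid_solve:
  assumes "cell_conn w g h p0 p1 p2 q0 q1 q2" and "h * h' = 1"
    and "mid_eq w M u q0 p1 p2 q1 q2" "mid_eq w M u q1 p2 p0 q2 q0" "mid_eq w M u q2 p0 p1 q0 q1"
  shows "mid_det M h h' * u q0 = mid_val w M h h' u p0 p1 p2 q0 q1 q2"
  unfolding mid_det_def mid_val_def
  by (rule inner_triangle_solve[where ?w10.0="w q1 q0" and ?w21.0="w q2 q1" and ?w12.0="w q1 q2" and ?w20.0="w q2 q0"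
        and ?Q1.0="u q1" and ?Q2.0="u q2"])
     (use assms in \<open>auto simp: cell_conn_def mid_eq_def algebra_simps\<close>)

lemma mid_val_mid_eq:
  assumes c: "cell_conn w g h p0 p1 p2 q0 q1 q2" and h: "h * h' = 1" and D: "mid_det M h h' \<noteq> 0"
    and Q: "mid_det M h h' * u q0 = mid_val w M h h' u p0 p1 p2 q0 q1 q2"
     "mid_det M h h' * u q1 = mid_val w M h h' u p1 p2 p0 q1 q2 q0"
     "mid_det M h h' * u q2 = mid_val w M h h' u p2 p0 p1 q2 q0 q1"
  shows "mid_eq w M u q0 p1 p2 q1 q2"
proof -
  let ?D = "mid_det M h h'"
  have "?D * (M * u q0) = M * mid_val w M h h' u p0 p1 p2 q0 q1 q2"
    unfolding Q(1)[symmetric] by simp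
  also have "\<dots> = ?D * (w q0 p1 * u p1 + w q0 p2 * u p2)
      + w q0 q1 * mid_val w M h h' u p1 p2 p0 q1 q2 q0 + w q0 q2 * mid_val w M h h' u p2 p0 p1 q2 q0 q1"
    unfolding mid_det_def mid_val_def
    by (rule inner_triangle_check) (use c h in \<open>auto simp: cell_conn_def\<close>)
  also have "\<dots> = ?D * (w q0 p1 * u p1 + w q0 p2 * u p2 + w q0 q1 * u q1 + w q0 q2 * u q2)"
    unfolding Q[symmetric] by (simp add: algebra_simps)
  finally show ?thesis using D by (simp add: mid_eq_def)
qed

text \<open>Each term of the substituted solution is a transport along a path through midpoints. A
  path to another corner equals the straight one times the holonomies of the triangles between them;
  a path back to \<open>p0\<close> is a backtrack or a loop around the corner triangle.\<close>

lemma corner_sum: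
  assumes c: "cell_conn w g h p0 p1 p2 q0 q1 q2" and gh: "g * g' = 1" "h * h' = 1"
    and E: "mid_eq w M u q0 p1 p2 q1 q2" "mid_eq w M u q1 p2 p0 q2 q0" "mid_eq w M u q2 p0 p1 q0 q1"
  shows "mid_det M h h' * (w p0 q2 * u q2 + w p0 q1 * u q1) =
    diag_coeff M g g' h h' * u p0 + edge_coeff M g' h' * (w p0 q2 * w q2 p1) * u p1
     + edge_coeff M g h * (w p0 q1 * w q1 p2) * u p2"
proof -
  have inv: "w p0 q2 * w q2 p0 = 1" "w q2 p1 * w p1 q2 = 1" "w p1 q0 * w q0 p1 = 1" "w q0 p2 * w p2 q0 = 1"
   "w p2 q1 * w q1 p2 = 1" "w q1 p0 * w p0 q1 = 1" "w q0 q1 * w q1 q0 = 1" "w q1 q2 * w q2 q1 = 1" "w q2 q0 * w q0 q2 = 1"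
   and hol: "w p0 q2 * w q2 q1 * w q1 p0 = g" "w p1 q0 * w q0 q2 * w q2 p1 = g"
    "w p2 q1 * w q1 q0 * w q0 p2 = g" "w q2 q0 * w q0 q1 * w q1 q2 = h"
    using c by (auto simp: cell_conn_def)
  have Q2: "mid_det M h h' * u q2 = mid_val w M h h' u p2 p0 p1 q2 q0 q1"
    by (rule mid_solve[OF cell_conn_rotate[OF cell_conn_rotate[OF c]] gh(2) E(3) E(1) E(2)])
  have Q1: "mid_det M h h' * u q1 = mid_val w M h h' u p1 p2 p0 q1 q2 q0"
    by (rule mid_solve[OF cell_conn_rotate[OF c] gh(2) E(2) E(3) E(1)])
  have a1: "w p0 q2 * w q2 q0 * w q0 p1 = g' * (w p0 q2 * w q2 p1)"
    using inv hol gh by algebra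
  have a2: "w p0 q1 * w q1 q2 * w q2 p1 = g' * (w p0 q2 * w q2 p1)"
    using inv(1,6,8) hol(1) gh by algebra
  \<comment> \<open>Between this path and the straight one lie the inner triangle and two corner
    triangles, hence one factor \<open>h'\<close> and two factors \<open>g'\<close>.\<close>
  have a3: "w p0 q1 * w q1 q0 * w q0 p1 = h' * g'^2 * (w p0 q2 * w q2 p1)"
  proof -
    have "w q1 q0 = h' * w q1 q2 * w q2 q0" using inv(7-9) hol(4) gh(2) by algebra
    then have "w p0 q1 * w q1 q0 * w q0 p1 = h' * (w p0 q1 * w q1 q2) * w q2 q0 * w q0 p1" by simp
    also have "w p0 q1 * w q1 q2 = g' * w p0 q2" using inv(1,6,8) hol(1) gh by algebra
    finally show ?thesis using a1 by algebra
  qed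
  \<comment> \<open>Towards \<open>p2\<close> the enclosed triangles are traversed in the opposite
    sense, so \<open>g\<close> and \<open>h\<close> replace their inverses.\<close>
  have b1: "w p0 q1 * w q1 q0 * w q0 p2 = g * (w p0 q1 * w q1 p2)"
    using inv(5) hol(3) gh by algebra
  have b2: "w p0 q2 * w q2 q1 * w q1 p2 = g * (w p0 q1 * w q1 p2)"
    using inv(6) hol(1) by algebra
  have b3: "w p0 q2 * w q2 q0 * w q0 p2 = h * g^2 * (w p0 q1 * w q1 p2)"
  proof -
    have "w q2 q0 = h * w q2 q1 * w q1 q0" using inv(7-9) hol(4) by algebra
    then have "w p0 q2 * w q2 q0 * w q0 p2 = h * (w p0 q2 * w q2 q1) * w q1 q0 * w q0 p2" by simp
    also have "w p0 q2 * w q2 q1 = g * w p0 q1" using inv(6) hol(1) by algebra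
    finally show ?thesis using b1 by algebra
  qed
  have c1: "w p0 q2 * w q2 q1 * w q1 p0 = g" "w p0 q1 * w q1 q2 * w q2 p0 = g'"
    "w p0 q2 * w q2 p0 = 1" "w p0 q1 * w q1 p0 = 1"
    subgoal using hol by simp
    subgoal using inv(1,6,8) hol(1) gh by algebra
    using inv by (simp_all add: mult_ac)
  have "mid_det M h h' * (w p0 q2 * u q2 + w p0 q1 * u q1) =
    w p0 q2 * mid_val w M h h' u p2 p0 p1 q2 q0 q1 + w p0 q1 * mid_val w M h h' u p1 p2 p0 q1 q2 q0"
    unfolding Q1[symmetric] Q2[symmetric] by (simp add: algebra_simps)
  also have "\<dots> =
    ((M^2-1) * (w p0 q2 * w q2 p0 + w p0 q1 * w q1 p0) + (M + h) * (w p0 q2 * w q2 q1 * w q1 p0)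
        + (M + h') * (w p0 q1 * w q1 q2 * w q2 p0)) * u p0
    + ((M^2-1) * (w p0 q2 * w q2 p1) + (M + h') * (w p0 q2 * w q2 q0 * w q0 p1)
        + (M + h') * (w p0 q1 * w q1 q2 * w q2 p1) + (M + h) * (w p0 q1 * w q1 q0 * w q0 p1)) * u p1
    + ((M^2-1) * (w p0 q1 * w q1 p2) + (M + h) * (w p0 q2 * w q2 q1 * w q1 p2)
        + (M + h) * (w p0 q1 * w q1 q0 * w q0 p2) + (M + h') * (w p0 q2 * w q2 q0 * w q0 p2)) * u p2"
    unfolding mid_val_def by algebra
  also have "\<dots> = diag_coeff M g g' h h' * u p0 + edge_coeff M g' h' * (w p0 q2 * w q2 p1) * u p1
     + edge_coeff M g h * (w p0 q1 * w q1 p2) * u p2"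
    unfolding a1 a2 a3 b1 b2 b3 c1 diag_coeff_def edge_coeff_def
    using gh by algebra
  finally show ?thesis .
qed

section \<open>Eigenspaces and their dimensions\<close>

text \<open>The scalar multiplication is literally the one in \<open>mult_L\<close>, so
  \<open>cfun.dim\<close> is the dimension used there.\<close>

interpretation cfun: vector_space "\<lambda>(c::complex) (u::'a \<Rightarrow> complex) x. c * u x"
  by unfold_locales (auto simp: algebra_simps)

text \<open>A basis of \<open>E\<close> is carried to a basis of the image. Injectivity is asked on
  \<open>E\<close> only, because restriction to even points is injective on eigenspaces but not on
  all functions.\<close>

lemma cfun_dim_image:
  fixes T :: "('a \<Rightarrow> complex) \<Rightarrow> 'b \<Rightarrow> complex"
  assumes T: "\<And>u v. T (u + v) = T u + T v" "\<And>c u. T (\<lambda>x. c * u x) = (\<lambda>x. c * T u x)"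
    and E: "cfun.subspace E" and inj: "inj_on T E"
  shows "cfun.dim (T ` E) = cfun.dim E"
proof -
  interpret T: module_hom "\<lambda>(c::complex) (u::'a \<Rightarrow> complex) x. c * u x"
      "\<lambda>(c::complex) (u::'b \<Rightarrow> complex) x. c * u x" T
    by unfold_locales (simp_all add: T)
  obtain B where B: "B \<subseteq> E" "cfun.independent B" "E \<subseteq> cfun.span B" "card B = cfun.dim E"
    using cfun.basis_exists by blast
  have span: "cfun.span B = E"
    using B E by (intro cfun.span_subspace)
  have "cfun.independent (T ` B)"
    using B(2) inj by (intro T.independent_injective_image) (auto simp: span)
  moreover have "cfun.span (T ` B) = T ` E"
    by (simp add: T.span_image span)
  moreover have "card (T ` B) = card B"
    using inj B(1) by (intro card_image) (rule inj_on_subset)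
  ultimately show ?thesis
    using B(4) cfun.dim_span_eq_card_independent[of "T ` B"] by simp
qed

text \<open>The point masses at the elements of \<open>V\<close> form a basis.\<close>

lemma cfun_dim_supported:
  assumes "finite V"
  shows "cfun.dim {u :: 'a \<Rightarrow> complex. \<forall>x. x \<notin> V \<longrightarrow> u x = 0} = card V"
proof -
  let ?d = "\<lambda>a x :: 'a. if x = a then 1 else 0 :: complex"
  have inj: "inj_on ?d V" by (auto simp: inj_on_def fun_eq_iff split: if_splits)
  have sum: "(\<Sum>a\<in>A. (\<lambda>x. c a * ?d a x)) = (\<lambda>x. if x \<in> A then c x else 0)"
      if "finite A" for A and c :: "'a \<Rightarrow> complex"
    using that by induction (auto simp: fun_eq_iff)
  have ind: "cfun.independent (?d ` V)"
  proof (rule cfun.independent_if_scalars_zero)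
    show "finite (?d ` V)" using assms by simp
  next
    fix f b assume z: "(\<Sum>b\<in>?d ` V. (\<lambda>x. f b * b x)) = 0" and b: "b \<in> ?d ` V"
    then have "(\<Sum>a\<in>V. (\<lambda>x. f (?d a) * ?d a x)) = 0"
      by (simp add: sum.reindex[OF inj])
    then have "(\<lambda>x. if x \<in> V then f (?d x) else 0) = 0"
      using sum[OF assms, of "\<lambda>a. f (?d a)"] by simp
    then show "f b = 0" using b by (auto simp: fun_eq_iff split: if_splits)
  qed
  have "cfun.span (?d ` V) = {u. \<forall>x. x \<notin> V \<longrightarrow> u x = 0}"
  proof (rule cfun.span_subspace)
    show "?d ` V \<subseteq> {u. \<forall>x. x \<notin> V \<longrightarrow> u x = 0}" by auto
    show "cfun.subspace {u. \<forall>x. x \<notin> V \<longrightarrow> u x = 0}"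
      by (rule cfun.subspaceI) auto
    show "{u. \<forall>x. x \<notin> V \<longrightarrow> u x = 0} \<subseteq> cfun.span (?d ` V)"
    proof
      fix u :: "'a \<Rightarrow> complex" assume "u \<in> {u. \<forall>x. x \<notin> V \<longrightarrow> u x = 0}"
      then have "u = (\<lambda>x. if x \<in> V then u x else 0)" by (auto simp: fun_eq_iff)
      also have "\<dots> = (\<Sum>a\<in>V. (\<lambda>x. u a * ?d a x))" by (rule sum[OF assms, symmetric])
      also have "\<dots> \<in> cfun.span (?d ` V)"
        by (intro cfun.span_sum cfun.span_scale cfun.span_base) auto
      finally show "u \<in> cfun.span (?d ` V)" .
    qed
  qed
  then show ?thesis
    using cfun.dim_span_eq_card_independent[OF ind] card_image[OF inj] by simp
qed

text \<open>The connection is arbitrary, since decimation produces one that agrees with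
  \<open>mag_conn\<close> only up to gauge. The equations are cleared of the degree in the
  denominator.\<close>

definition mag_eigenspace :: "nat
    \<Rightarrow> (pt \<Rightarrow> pt \<Rightarrow> complex) \<Rightarrow> real \<Rightarrow> (pt \<Rightarrow> complex) set" where
  "mag_eigenspace n w lam = {u. (\<forall>x. x \<notin> sg_verts n \<longrightarrow> u x = 0) \<and>
     (\<forall>x\<in>sg_verts n. (\<Sum>y\<in>sg_nbrs n x. w x y * u y) = of_real (1 - lam) * of_nat (sg_deg n x) * u x)}"

lemma eigenspace_L_eq: "eigenspace_L n \<alpha> \<beta> lam = mag_eigenspace n (mag_conn \<alpha> \<beta>) lam"
proof -
  have "mag_lap n \<alpha> \<beta> u x = of_real lam * u x \<longleftrightarrow>
     (\<Sum>y\<in>sg_nbrs n x. mag_conn \<alpha> \<beta> x y * u y) = of_real (1 - lam) * of_nat (sg_deg n x) * u x"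
    if "x \<in> sg_verts n" for u x
  proof -
    have eq: "mag_lap n \<alpha> \<beta> u x =
        (of_nat (sg_deg n x) * u x - (\<Sum>y\<in>sg_nbrs n x. mag_conn \<alpha> \<beta> x y * u y)) / of_nat (sg_deg n x)"
      by (simp add: mag_lap_def sum_subtractf sg_deg_def flip: sum_divide_distrib)
    then show ?thesis
      using sg_deg_pos[OF that] unfolding eq
      by (simp add: nonzero_divide_eq_eq) (simp add: algebra_simps, metis)
  qed
  then show ?thesis by (auto simp: eigenspace_L_def mag_eigenspace_def)
qed

lemma subspace_mag_eigenspace: "cfun.subspace (mag_eigenspace n w lam)"
proof (rule cfun.subspaceI)
  show "0 \<in> mag_eigenspace n w lam" by (simp add: mag_eigenspace_def)
next
  fix u v assume "u \<in> mag_eigenspace n w lam" "v \<in> mag_eigenspace n w lam"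
  then show "u + v \<in> mag_eigenspace n w lam"
    by (simp add: mag_eigenspace_def distrib_left sum.distrib)
next
  fix c u assume "u \<in> mag_eigenspace n w lam"
  then show "(\<lambda>x. c * u x) \<in> mag_eigenspace n w lam"
    by (simp add: mag_eigenspace_def mult.left_commute[of _ c] flip: sum_distrib_left)
qed

section \<open>Connections with prescribed holonomies\<close>

lemma sg_nbrs_lat_adj:
  assumes "y \<in> sg_nbrs n x"
  shows "lat_adj x y"
proof -
  obtain i j where "x \<in> up_tri (i,j)" "y \<in> up_tri (i,j)" "x \<noteq> y"
    using assms by (auto simp: sg_nbrs_def sg_edges_cells)
  then show ?thesis
    by (auto simp: up_tri_def lat_adj_def)
qed

lemma int_recurrence_exists:
  fixes f :: "int \<Rightarrow> complex"
  assumes "\<And>n. f n \<noteq> 0" "c \<noteq> 0"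
  obtains F where "F 0 = c" "\<And>n. F (n + 1) = f n * F n" "\<And>n. F n \<noteq> 0"
proof -
  \<comment> \<open>For negative \<open>n\<close> the recurrence is run backwards, dividing by the
    factors at -1, -2, down to \<open>n\<close>.\<close>
  define F where "F n = (if n \<ge> 0 then c * (\<Prod>i<nat n. f (int i)) else c / (\<Prod>i<nat (-n). f (- int i - 1)))" for n
  have rec: "F (n + 1) = f n * F n" for n
  proof (cases "n \<ge> 0")
    case True
    then have "nat (n + 1) = Suc (nat n)" by simp
    then show ?thesis using True by (simp add: F_def)
  next
    case False
    then have 1: "nat (- n) = Suc (nat (- n - 1))" by simp
    have 2: "int (nat (- n - 1)) = - n - 1" using False by simp
    have "F n = c / ((\<Prod>i<nat (-n-1). f (- int i - 1)) * f n)"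
      using False by (simp only: F_def 1 prod.lessThan_Suc 2) simp
    moreover have "F (n + 1) = c / (\<Prod>i<nat (-n-1). f (- int i - 1))"
      using False by (auto simp: F_def)
    ultimately show ?thesis using assms by simp
  qed
  show ?thesis
    by (rule that[of F, OF _ rec]) (use assms in \<open>auto simp: F_def\<close>)
qed

text \<open>Landau gauge: edges in direction e2 are trivial and the phases depend only on the
  height, each unit parallelogram having flux \<alpha>+\<beta>. The \<open>b-1\<close> for direction
  (1,-1) is the height of the lower end, as the reversed edge requires. It witnesses the choice in
  \<open>mag_conn\<close>.\<close>

definition standard_conn :: "real \<Rightarrow> real \<Rightarrow> pt \<Rightarrow> pt \<Rightarrow> complex" where
  "standard_conn \<alpha> \<beta> x y = (let b = of_int (snd x); d = (fst y - fst x, snd y - snd x) in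
     if d = (1,0) then cis (- 2*pi*(\<alpha>+\<beta>)*b)
     else if d = (-1,0) then cis (2*pi*(\<alpha>+\<beta>)*b)
     else if d = (-1,1) then cis (2*pi*(\<alpha>+(\<alpha>+\<beta>)*b))
     else if d = (1,-1) then cis (- 2*pi*(\<alpha>+(\<alpha>+\<beta>)*(b-1)))
     else 1)"

lemma standard_conn:
  "unitary_connection (standard_conn \<alpha> \<beta>)" "has_holonomy (standard_conn \<alpha> \<beta>) \<alpha> \<beta>"
proof -
  have "cmod (standard_conn \<alpha> \<beta> x y) = 1" for x y
    by (simp add: standard_conn_def Let_def)
  moreover have "standard_conn \<alpha> \<beta> y x = cnj (standard_conn \<alpha> \<beta> x y)" if "lat_adj x y" for x y
  proof -
    obtain a b where x: "x = (a, b)" by (cases x)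
    from that consider "y = (a+1,b)" | "y = (a-1,b)" | "y = (a,b+1)" | "y = (a,b-1)" | "y = (a-1,b+1)" | "y = (a+1,b-1)"
      by (cases y) (auto simp: lat_adj_def x algebra_simps)
    then show ?thesis
      by cases (simp_all add: standard_conn_def x cis_cnj)
  qed
  ultimately show "unitary_connection (standard_conn \<alpha> \<beta>)"
    by (simp add: unitary_connection_def)
  show "has_holonomy (standard_conn \<alpha> \<beta>) \<alpha> \<beta>"
    unfolding has_holonomy_def
  proof (intro conjI allI)
    fix a b :: int
    show "standard_conn \<alpha> \<beta> (a,b) (a+1,b) * standard_conn \<alpha> \<beta> (a+1,b) (a,b+1) * standard_conn \<alpha> \<beta> (a,b+1) (a,b)
        = cis (2*pi*\<alpha>)"
      by (simp add: standard_conn_def cis_mult) (simp add: algebra_simps)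
    show "standard_conn \<alpha> \<beta> (a+1,b) (a+1,b+1) * standard_conn \<alpha> \<beta> (a+1,b+1) (a,b+1) * standard_conn \<alpha> \<beta> (a,b+1) (a+1,b)
        = cis (2*pi*\<beta>)"
      by (simp add: standard_conn_def cis_mult) (simp add: algebra_simps)
  qed
qed

lemma mag_conn: "unitary_connection (mag_conn \<alpha> \<beta>)" "has_holonomy (mag_conn \<alpha> \<beta>) \<alpha> \<beta>"
  using someI[of "\<lambda>w. unitary_connection w \<and> has_holonomy w \<alpha> \<beta>" "standard_conn \<alpha> \<beta>"] standard_conn
  unfolding mag_conn_def by blast+

section \<open>Gauge equivalence\<close>

lemma unitary_connection_inverse:
  assumes "unitary_connection w" "lat_adj x y"
  shows "w x y * w y x = 1"
proof -
  have "cmod (w x y) = 1" "w y x = cnj (w x y)"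
    using assms unfolding unitary_connection_def by blast+
  then show ?thesis by (simp add: complex_norm_square[symmetric])
qed

text \<open>The quotient \<open>r\<close> of the two connections has trivial holonomy around every
  unit triangle, so it has a potential on the simply connected lattice; that potential is the
  gauge.\<close>

lemma gauge_exists:
  assumes w: "unitary_connection w" "has_holonomy w \<alpha> \<beta>" and w': "unitary_connection w'" "has_holonomy w' \<alpha> \<beta>"
  obtains g where "\<And>x. g x \<noteq> 0" "\<And>x y. lat_adj x y \<Longrightarrow> w' x y * g y = g x * w x y"
proof -
  define r where "r x y = w x y / w' x y" for x y
  have nz: "w x y \<noteq> 0" "w' x y \<noteq> 0" if "lat_adj x y" for x y
    using unitary_connection_inverse[OF w(1) that] unitary_connection_inverse[OF w'(1) that] by auto
  have rnz: "r x y \<noteq> 0" if "lat_adj x y" for x y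
    using nz[OF that] by (simp add: r_def)
  have rinv: "r x y * r y x = 1" if "lat_adj x y" for x y
  proof -
    have "w x y * w y x = 1" "w' x y * w' y x = 1"
      using unitary_connection_inverse[OF w(1) that] unitary_connection_inverse[OF w'(1) that] by auto
    then show ?thesis by (simp add: r_def)
  qed
  have up: "r (a,b) (a+1,b) * r (a+1,b) (a,b+1) * r (a,b+1) (a,b) = 1"
   and down: "r (a+1,b) (a+1,b+1) * r (a+1,b+1) (a,b+1) * r (a,b+1) (a+1,b) = 1" for a b
    using w(2) w'(2) by (simp_all add: r_def has_holonomy_def)
  \<comment> \<open>The potential is integrated along the row of height 0 and from there along every
    column. Only the remaining horizontal and diagonal edges have to be checked.\<close>
  obtain G0 where G0: "G0 0 = 1" "\<And>a. G0 (a + 1) = r (a,0) (a+1,0) * G0 a" "\<And>a. G0 a \<noteq> 0"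
    by (rule int_recurrence_exists[of "\<lambda>a. r (a,0) (a+1,0)" 1]) (auto simp: rnz lat_adj_def)
  have "\<exists>F. F 0 = G0 a \<and> (\<forall>b. F (b + 1) = r (a,b) (a,b+1) * F b) \<and> (\<forall>b. F b \<noteq> 0)" for a
    by (rule int_recurrence_exists[of "\<lambda>b. r (a,b) (a,b+1)" "G0 a"]) (auto simp: rnz lat_adj_def G0)
  then obtain F where F: "\<And>a. F a 0 = G0 a" "\<And>a b. F a (b + 1) = r (a,b) (a,b+1) * F a b" "\<And>a b. F a b \<noteq> 0"
    by metis
  define g where "g x = F (fst x) (snd x)" for x
  define ok where "ok x y \<longleftrightarrow> g y = g x * r x y" for x y
  have gnz: "g x \<noteq> 0" for x by (simp add: g_def F)
  have sym: "ok y x" if "ok x y" "lat_adj x y" for x y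
    using that rinv[of x y] by (simp add: ok_def)
  have tri: "ok z x" if "ok x y" "ok y z" "r x y * r y z * r z x = 1" for x y z
    using that by (simp add: ok_def mult.assoc)
  have vert: "ok (a,b) (a,b+1)" for a b
    by (simp add: ok_def g_def F)
  have hor_diag: "ok (a+1,b) (a,b+1)" if "ok (a,b) (a+1,b)" for a b
  proof (rule tri)
    show "ok (a,b+1) (a,b)" by (rule sym[OF vert]) (simp add: lat_adj_def)
    show "ok (a,b) (a+1,b)" by fact
    show "r (a,b+1) (a,b) * r (a,b) (a+1,b) * r (a+1,b) (a,b+1) = 1"
      using up[of a b] by (simp add: mult_ac)
  qed
  \<comment> \<open>Compatibility passes from one row to the next, upwards and downwards, through
    one upward and one downward triangle whose other edges are already compatible.\<close>
  have hor: "\<forall>a. ok (a,b) (a+1,b)" for b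
  proof (induction b rule: int_induct[where k=0])
    case base
    show ?case by (simp add: ok_def g_def F G0)
  next
    case (step1 b)
    show ?case
    proof
      fix a
      have "ok (a,b+1) (a+1,b)" by (rule sym[OF hor_diag]) (use step1 in \<open>auto simp: lat_adj_def\<close>)
      moreover have "ok (a+1,b) (a+1,b+1)" by (rule vert)
      ultimately have "ok (a+1,b+1) (a,b+1)"
        by (rule tri) (use down[of a b] in \<open>simp add: mult_ac\<close>)
      then show "ok (a,b+1) (a+1,b+1)" by (rule sym) (simp add: lat_adj_def)
    qed
  next
    case (step2 b)
    show ?case
    proof
      fix a
      have "ok (a+1,b) (a,b)" by (rule sym) (use step2 in \<open>auto simp: lat_adj_def\<close>)
      moreover have "ok (a+1,b-1) (a+1,b)" using vert[of "a+1" "b-1"] by simp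
      ultimately have "ok (a,b) (a+1,b-1)"
        using tri[of "(a+1,b-1)" "(a+1,b)" "(a,b)"] down[of a "b-1"] by simp
      then have "ok (a+1,b-1) (a,b)" by (rule sym) (simp add: lat_adj_def)
      moreover have "ok (a,b) (a,b-1)"
        using sym[OF vert[of a "b-1"]] by (simp add: lat_adj_def)
      ultimately show "ok (a,b-1) (a+1,b-1)"
        by (rule tri) (use up[of a "b-1"] in \<open>simp add: mult_ac\<close>)
    qed
  qed
  have "ok x y" if "lat_adj x y" for x y
  proof -
    obtain a b where x: "x = (a, b)" by (cases x)
    from that consider "y = (a+1,b)" | "y = (a-1,b)" | "y = (a,b+1)" | "y = (a,b-1)" | "y = (a-1,b+1)" | "y = (a+1,b-1)"
      by (cases y) (auto simp: lat_adj_def x algebra_simps)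
    then show ?thesis
    proof cases
      case 1 then show ?thesis using hor x by blast
    next
      case 2 then show ?thesis using sym[of "(a-1,b)" "(a,b)"] hor[of b, rule_format, of "a-1"] x by (simp add: lat_adj_def)
    next
      case 3 then show ?thesis using vert x by blast
    next
      case 4 then show ?thesis using sym[OF vert[of a "b-1"]] x by (simp add: lat_adj_def)
    next
      case 5 then show ?thesis using hor_diag[of "a-1" b] hor[of b, rule_format, of "a-1"] x by simp
    next
      case 6 then show ?thesis
        using sym[OF hor_diag[of a "b-1"]] hor[of "b-1", rule_format, of a] x by (simp add: lat_adj_def)
    qed
  qed
  then have "w' x y * g y = g x * w x y" if "lat_adj x y" for x y
    using that nz[OF that] by (simp add: ok_def r_def)
  then show ?thesis using that gnz by blast
qed

lemma gauge_mag_eigenspace: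
  assumes g: "\<And>x. g x \<noteq> 0" "\<And>x y. lat_adj x y \<Longrightarrow> w' x y * g y = g x * w x y"
  shows "(\<lambda>x. g x * u x) \<in> mag_eigenspace n w' lam \<longleftrightarrow> u \<in> mag_eigenspace n w lam"
proof -
  have "(\<Sum>y\<in>sg_nbrs n x. w' x y * (g y * u y)) = g x * (\<Sum>y\<in>sg_nbrs n x. w x y * u y)" for x
    unfolding sum_distrib_left
    by (intro sum.cong refl) (metis g(2) mult.assoc sg_nbrs_lat_adj)
  then show ?thesis
    using g(1) by (simp add: mag_eigenspace_def mult.left_commute[of _ "g _"])
qed

text \<open>Pointwise multiplication by a nowhere vanishing gauge is a linear bijection between the
  eigenspaces. Hence the particular choice in \<open>mag_conn\<close> does not affect the spectral
  data.\<close>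

lemma gauge_equivalent:
  assumes "unitary_connection w" "has_holonomy w \<alpha> \<beta>" "unitary_connection w'" "has_holonomy w' \<alpha> \<beta>"
  shows "cfun.dim (mag_eigenspace n w lam) = cfun.dim (mag_eigenspace n w' lam)"
    and "(\<exists>u\<in>mag_eigenspace n w lam. u \<noteq> 0) \<longleftrightarrow> (\<exists>u\<in>mag_eigenspace n w' lam. u \<noteq> 0)"
proof -
  obtain g where g: "\<And>x. g x \<noteq> 0" "\<And>x y. lat_adj x y \<Longrightarrow> w' x y * g y = g x * w x y"
    using gauge_exists[OF assms] by blast
  let ?T = "\<lambda>u x. g x * u x"
  have "v \<in> ?T ` mag_eigenspace n w lam" if "v \<in> mag_eigenspace n w' lam" for v
  proof
    show v: "v = ?T (\<lambda>x. v x / g x)" using g(1) by simp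
    then show "(\<lambda>x. v x / g x) \<in> mag_eigenspace n w lam"
      using gauge_mag_eigenspace[where w'=w', OF g] that by metis
  qed
  then have im: "?T ` mag_eigenspace n w lam = mag_eigenspace n w' lam"
    using gauge_mag_eigenspace[where w'=w', OF g] by blast
  have inj: "inj ?T" using g(1) by (auto simp: inj_def fun_eq_iff)
  show "cfun.dim (mag_eigenspace n w lam) = cfun.dim (mag_eigenspace n w' lam)"
    unfolding im[symmetric]
    by (rule cfun_dim_image[symmetric, OF _ _ subspace_mag_eigenspace inj_on_subset[OF inj subset_UNIV]])
       (simp_all add: fun_eq_iff algebra_simps)
  have "?T u = 0 \<longleftrightarrow> u = 0" for u using g(1) by (auto simp: fun_eq_iff)
  then show "(\<exists>u\<in>mag_eigenspace n w lam. u \<noteq> 0)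
      \<longleftrightarrow> (\<exists>u\<in>mag_eigenspace n w' lam. u \<noteq> 0)"
    unfolding im[symmetric] by simp
qed

lemma conn_cell:
  assumes w: "unitary_connection w" "has_holonomy w \<alpha> \<beta>"
  shows "cell_conn w (cis (2*pi*\<alpha>)) (cis (2*pi*\<beta>))
     (2*i,2*j) (2*i+2,2*j) (2*i,2*j+2) (2*i+1,2*j+1) (2*i,2*j+1) (2*i+1,2*j)"
proof -
  note inv = unitary_connection_inverse[OF w(1)]
  have up: "w (a,b) (a+1,b) * w (a+1,b) (a,b+1) * w (a,b+1) (a,b) = cis (2*pi*\<alpha>)"
   and down: "w (a+1,b) (a+1,b+1) * w (a+1,b+1) (a,b+1) * w (a,b+1) (a+1,b) = cis (2*pi*\<beta>)" for a b
    using w(2) by (simp_all add: has_holonomy_def)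
  show ?thesis
    unfolding cell_conn_def
    using up[of "2*i" "2*j"] up[of "2*i+1" "2*j"] up[of "2*i" "2*j+1"] down[of "2*i" "2*j"]
    by (simp add: inv lat_adj_def add.commute mult_ac)
qed

section \<open>Decimation\<close>

definition mids_ok :: "(pt \<Rightarrow> pt \<Rightarrow> complex) \<Rightarrow> complex
    \<Rightarrow> (pt \<Rightarrow> complex) \<Rightarrow> int \<Rightarrow> int \<Rightarrow> bool" where
  "mids_ok w M u i j \<longleftrightarrow>
     mid_eq w M u (2*i+1,2*j+1) (2*i+2,2*j) (2*i,2*j+2) (2*i,2*j+1) (2*i+1,2*j) \<and>
     mid_eq w M u (2*i,2*j+1) (2*i,2*j+2) (2*i,2*j) (2*i+1,2*j) (2*i+1,2*j+1) \<and>
     mid_eq w M u (2*i+1,2*j) (2*i,2*j) (2*i+2,2*j) (2*i+1,2*j+1) (2*i,2*j+1)"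

text \<open>The vertices split by parity. A midpoint has degree 4 and all its neighbours in one cell
  of side 2, which gives \<open>M = 4 * (1 - lam)\<close>; an even vertex keeps the degree it has in
  the coarser graph.\<close>

lemma mag_eigenspace_Suc_iff:
  "u \<in> mag_eigenspace (Suc n) w lam \<longleftrightarrow>
     (\<forall>x. x \<notin> sg_verts (Suc n) \<longrightarrow> u x = 0) \<and>
     (\<forall>(i,j)\<in>sg_cells n. mids_ok w (of_real (4 * (1 - lam))) u i j) \<and>
     (\<forall>(i,j)\<in>sg_verts n. (\<Sum>y\<in>sg_nbrs (Suc n) (2*i,2*j). w (2*i,2*j) y * u y) =
        of_real (1 - lam) * of_nat (sg_deg n (i,j)) * u (2*i,2*j))"
proof -
  let ?eq = "\<lambda>x. (\<Sum>y\<in>sg_nbrs (Suc n) x. w x y * u y) = of_real (1 - lam) * of_nat (sg_deg (Suc n) x) * u x"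
  have split: "(\<forall>x\<in>sg_verts (Suc n). P x) \<longleftrightarrow>
     (\<forall>(i,j)\<in>sg_cells n. P (2*i+1,2*j+1) \<and> P (2*i,2*j+1) \<and> P (2*i+1,2*j)) \<and>
     (\<forall>(i,j)\<in>sg_verts n. P (2*i,2*j))" (is "?l \<longleftrightarrow> ?r") for P :: "pt \<Rightarrow> bool"
  proof
    assume ?l then show ?r by (auto simp: sg_verts_Suc_iff)
  next
    assume r: ?r
    show ?l
    proof
      fix x assume "x \<in> sg_verts (Suc n)"
      then show "P x" using r by (cases x rule: pt_parity_cases) (auto simp: sg_verts_Suc_iff)
    qed
  qed
  have mids: "?eq (2*i+1,2*j+1) \<and> ?eq (2*i,2*j+1) \<and> ?eq (2*i+1,2*j) \<longleftrightarrow>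
      mids_ok w (of_real (4 * (1 - lam))) u i j" if "(i,j) \<in> sg_cells n" for i j
    using that unfolding mids_ok_def mid_eq_def
    by (simp add: sum_sg_nbrs sg_deg_eq sg_cells_Suc_iff sg_cells_Suc_pred_iff) (simp add: algebra_simps eq_commute[of "4 * _"])
  have deg: "sg_deg (Suc n) (2*i,2*j) = sg_deg n (i,j)" for i j
    by (simp add: sg_deg_eq sg_cells_Suc_iff sg_cells_Suc_pred_iff)
  have "u \<in> mag_eigenspace (Suc n) w lam
      \<longleftrightarrow> (\<forall>x. x \<notin> sg_verts (Suc n) \<longrightarrow> u x = 0)
        \<and> (\<forall>x\<in>sg_verts (Suc n). ?eq x)"
    by (simp add: mag_eigenspace_def)
  also have "(\<forall>x\<in>sg_verts (Suc n). ?eq x) \<longleftrightarrow>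
     (\<forall>(i,j)\<in>sg_cells n. mids_ok w (of_real (4 * (1 - lam))) u i j) \<and>
     (\<forall>(i,j)\<in>sg_verts n. ?eq (2*i,2*j))"
    unfolding split[of ?eq] using mids by blast
  finally show ?thesis unfolding deg .
qed

text \<open>
  The three listed directions are those of the edges that run counterclockwise around an upward triangle.
\<close>

definition reduced_conn :: "(pt \<Rightarrow> pt \<Rightarrow> complex) \<Rightarrow> complex \<Rightarrow> complex \<Rightarrow> pt \<Rightarrow> pt \<Rightarrow> complex" where
  "reduced_conn w e e' x y =
     (if (fst y - fst x, snd y - snd x) \<in> {(1,0), (-1,1), (0,-1)} then e else e')
     * (w (2 * fst x, 2 * snd x) (fst x + fst y, snd x + snd y)
      * w (fst x + fst y, snd x + snd y) (2 * fst y, 2 * snd y))"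

text \<open>The diagonal term occurs once for each cell at the vertex, that is, half the degree many
  times.\<close>

lemma cells_sum_distrib:
  fixes t :: complex
  shows "(if a then t * v + x1 + x2 else 0) + (if b then t * v + y1 + y2 else 0) + (if c then t * v + z1 + z2 else 0) =
    t * (of_nat (2 * (of_bool a + of_bool b + of_bool c)) / 2) * v
    + ((if a then x1 + x2 else 0) + (if b then y1 + y2 else 0) + (if c then z1 + z2 else 0))"
  by (cases a; cases b; cases c; simp add: algebra_simps)

text \<open>The conjugate phases \<open>g'\<close> and \<open>h'\<close> are separate constants tied
  to \<open>g\<close> and \<open>h\<close> by \<open>holonomy_inverse\<close>, so that the cell
  identities are polynomial.\<close>

locale decimation =
  fixes w \<alpha> \<beta> lam g g' h h' M D d e e'
  assumes w: "unitary_connection w" "has_holonomy w \<alpha> \<beta>"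
  defines "g \<equiv> cis (2*pi*\<alpha>)" and "g' \<equiv> cis (- 2*pi*\<alpha>)"
    and "h \<equiv> cis (2*pi*\<beta>)" and "h' \<equiv> cis (- 2*pi*\<beta>)"
    and "M \<equiv> complex_of_real (4 * (1 - lam))"
    and "D \<equiv> mid_det M h h'" and "d \<equiv> diag_coeff M g g' h h'"
    and "e \<equiv> edge_coeff M g' h'" and "e' \<equiv> edge_coeff M g h"
begin

lemma holonomy_inverse: "g * g' = 1" "h * h' = 1"
  by (simp_all add: g_def g'_def h_def h'_def cis_mult)

lemma cell_corner_sums:
  assumes "mids_ok w M u i j"
  shows "D * (w (2*i,2*j) (2*i+1,2*j) * u (2*i+1,2*j) + w (2*i,2*j) (2*i,2*j+1) * u (2*i,2*j+1)) =
     d * u (2*i,2*j) + reduced_conn w e e' (i,j) (i+1,j) * u (2*i+2,2*j) + reduced_conn w e e' (i,j) (i,j+1) * u (2*i,2*j+2)"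
  and "D * (w (2*i+2,2*j) (2*i+1,2*j+1) * u (2*i+1,2*j+1) + w (2*i+2,2*j) (2*i+1,2*j) * u (2*i+1,2*j)) =
     d * u (2*i+2,2*j) + reduced_conn w e e' (i+1,j) (i,j+1) * u (2*i,2*j+2) + reduced_conn w e e' (i+1,j) (i,j) * u (2*i,2*j)"
  and "D * (w (2*i,2*j+2) (2*i,2*j+1) * u (2*i,2*j+1) + w (2*i,2*j+2) (2*i+1,2*j+1) * u (2*i+1,2*j+1)) =
     d * u (2*i,2*j+2) + reduced_conn w e e' (i,j+1) (i,j) * u (2*i,2*j) + reduced_conn w e e' (i,j+1) (i+1,j) * u (2*i+2,2*j)"
proof -
  note c0 = conn_cell[OF w, folded g_def h_def, of i j]
  note c1 = cell_conn_rotate[OF c0]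
  note c2 = cell_conn_rotate[OF c1]
  have m: "mid_eq w M u (2*i+1,2*j+1) (2*i+2,2*j) (2*i,2*j+2) (2*i,2*j+1) (2*i+1,2*j)"
     "mid_eq w M u (2*i,2*j+1) (2*i,2*j+2) (2*i,2*j) (2*i+1,2*j) (2*i+1,2*j+1)"
     "mid_eq w M u (2*i+1,2*j) (2*i,2*j) (2*i+2,2*j) (2*i+1,2*j+1) (2*i,2*j+1)"
    using assms by (auto simp: mids_ok_def)
  show "D * (w (2*i,2*j) (2*i+1,2*j) * u (2*i+1,2*j) + w (2*i,2*j) (2*i,2*j+1) * u (2*i,2*j+1)) =
     d * u (2*i,2*j) + reduced_conn w e e' (i,j) (i+1,j) * u (2*i+2,2*j) + reduced_conn w e e' (i,j) (i,j+1) * u (2*i,2*j+2)"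
    using corner_sum[OF c0 holonomy_inverse m(1) m(2) m(3)]
    unfolding D_def[symmetric] d_def[symmetric] e_def[symmetric] e'_def[symmetric]
    by (simp add: reduced_conn_def algebra_simps)
  show "D * (w (2*i+2,2*j) (2*i+1,2*j+1) * u (2*i+1,2*j+1) + w (2*i+2,2*j) (2*i+1,2*j) * u (2*i+1,2*j)) =
     d * u (2*i+2,2*j) + reduced_conn w e e' (i+1,j) (i,j+1) * u (2*i,2*j+2) + reduced_conn w e e' (i+1,j) (i,j) * u (2*i,2*j)"
    using corner_sum[OF c1 holonomy_inverse m(2) m(3) m(1)]
    unfolding D_def[symmetric] d_def[symmetric] e_def[symmetric] e'_def[symmetric]
    by (simp add: reduced_conn_def algebra_simps)
  show "D * (w (2*i,2*j+2) (2*i,2*j+1) * u (2*i,2*j+1) + w (2*i,2*j+2) (2*i+1,2*j+1) * u (2*i+1,2*j+1)) =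
     d * u (2*i,2*j+2) + reduced_conn w e e' (i,j+1) (i,j) * u (2*i,2*j) + reduced_conn w e e' (i,j+1) (i+1,j) * u (2*i+2,2*j)"
    using corner_sum[OF c2 holonomy_inverse m(3) m(1) m(2)]
    unfolding D_def[symmetric] d_def[symmetric] e_def[symmetric] e'_def[symmetric]
    by (simp add: reduced_conn_def algebra_simps)
qed

lemma corner_reduction:
  assumes "\<forall>(i,j)\<in>sg_cells n. mids_ok w M u i j"
  shows "D * (\<Sum>y\<in>sg_nbrs (Suc n) (2*i,2*j). w (2*i,2*j) y * u y) =
    d * (of_nat (sg_deg n (i,j)) / 2) * u (2*i,2*j)
    + (\<Sum>y\<in>sg_nbrs n (i,j). reduced_conn w e e' (i,j) y * u (2 * fst y, 2 * snd y))"
proof -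
  have 1: "D * (if (i,j) \<in> sg_cells n then
        w (2*i,2*j) (2*i+1,2*j) * u (2*i+1,2*j) + w (2*i,2*j) (2*i,2*j+1) * u (2*i,2*j+1) else 0)
     = (if (i,j) \<in> sg_cells n then d * u (2*i,2*j) + reduced_conn w e e' (i,j) (i+1,j) * u (2*(i+1),2*j)
         + reduced_conn w e e' (i,j) (i,j+1) * u (2*i,2*(j+1)) else 0)"
    using assms cell_corner_sums(1)[of u i j] by (auto simp: algebra_simps)
  have 2: "D * (if (i-1,j) \<in> sg_cells n then
        w (2*i,2*j) (2*i-1,2*j) * u (2*i-1,2*j) + w (2*i,2*j) (2*i-1,2*j+1) * u (2*i-1,2*j+1) else 0)
     = (if (i-1,j) \<in> sg_cells n then d * u (2*i,2*j) + reduced_conn w e e' (i,j) (i-1,j) * u (2*(i-1),2*j)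
         + reduced_conn w e e' (i,j) (i-1,j+1) * u (2*(i-1),2*(j+1)) else 0)"
    using assms cell_corner_sums(2)[of u "i-1" j] by (auto simp: algebra_simps)
  have 3: "D * (if (i,j-1) \<in> sg_cells n then
        w (2*i,2*j) (2*i,2*j-1) * u (2*i,2*j-1) + w (2*i,2*j) (2*i+1,2*j-1) * u (2*i+1,2*j-1) else 0)
     = (if (i,j-1) \<in> sg_cells n then d * u (2*i,2*j) + reduced_conn w e e' (i,j) (i,j-1) * u (2*i,2*(j-1))
         + reduced_conn w e e' (i,j) (i+1,j-1) * u (2*(i+1),2*(j-1)) else 0)"
    using assms cell_corner_sums(3)[of u i "j-1"] by (auto simp: algebra_simps)
  have S: "(\<Sum>y\<in>sg_nbrs (Suc n) (2*i,2*j). w (2*i,2*j) y * u y) =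
      (if (i,j) \<in> sg_cells n then
        w (2*i,2*j) (2*i+1,2*j) * u (2*i+1,2*j) + w (2*i,2*j) (2*i,2*j+1) * u (2*i,2*j+1) else 0) +
      (if (i-1,j) \<in> sg_cells n then
        w (2*i,2*j) (2*i-1,2*j) * u (2*i-1,2*j) + w (2*i,2*j) (2*i-1,2*j+1) * u (2*i-1,2*j+1) else 0) +
      (if (i,j-1) \<in> sg_cells n then
        w (2*i,2*j) (2*i,2*j-1) * u (2*i,2*j-1) + w (2*i,2*j) (2*i+1,2*j-1) * u (2*i+1,2*j-1) else 0)"
    by (simp only: sum_sg_nbrs sg_cells_Suc_iff sg_cells_Suc_pred_iff)
  show ?thesis
    unfolding S distrib_left[of D] 1 2 3 sum_sg_nbrs[of _ n] sg_deg_eq fst_conv snd_conv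
    by (rule cells_sum_distrib)
qed

end

abbreviation restrict_even :: "(pt \<Rightarrow> complex) \<Rightarrow> pt \<Rightarrow> complex" where
  "restrict_even u \<equiv> \<lambda>x. u (2 * fst x, 2 * snd x)"

context decimation begin

text \<open>These are the corner equations multiplied by \<open>D\<close> after elimination, with
  the diagonal part \<open>d / 2\<close> moved to the right. Leaving them unnormalised covers
  vanishing \<open>Psi_fn\<close> too.\<close>

definition reduced_eigenspace :: "nat \<Rightarrow> (pt \<Rightarrow> complex) set" where
  "reduced_eigenspace n = {v. (\<forall>x. x \<notin> sg_verts n \<longrightarrow> v x = 0) \<and>
     (\<forall>x\<in>sg_verts n. (\<Sum>y\<in>sg_nbrs n x. reduced_conn w e e' x y * v y)
        = (D * of_real (1 - lam) - d / 2) * of_nat (sg_deg n x) * v x)}"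

lemma mids_ok_solve:
  assumes "mids_ok w M u i j"
  shows "D * u (2*i+1,2*j+1) = mid_val w M h h' u (2*i,2*j) (2*i+2,2*j) (2*i,2*j+2) (2*i+1,2*j+1) (2*i,2*j+1) (2*i+1,2*j)"
    and "D * u (2*i,2*j+1) = mid_val w M h h' u (2*i+2,2*j) (2*i,2*j+2) (2*i,2*j) (2*i,2*j+1) (2*i+1,2*j) (2*i+1,2*j+1)"
    and "D * u (2*i+1,2*j) = mid_val w M h h' u (2*i,2*j+2) (2*i,2*j) (2*i+2,2*j) (2*i+1,2*j) (2*i+1,2*j+1) (2*i,2*j+1)"
proof -
  note c0 = conn_cell[OF w, folded g_def h_def, of i j]
  note c1 = cell_conn_rotate[OF c0]
  note c2 = cell_conn_rotate[OF c1]
  have m: "mid_eq w M u (2*i+1,2*j+1) (2*i+2,2*j) (2*i,2*j+2) (2*i,2*j+1) (2*i+1,2*j)"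
     "mid_eq w M u (2*i,2*j+1) (2*i,2*j+2) (2*i,2*j) (2*i+1,2*j) (2*i+1,2*j+1)"
     "mid_eq w M u (2*i+1,2*j) (2*i,2*j) (2*i+2,2*j) (2*i+1,2*j+1) (2*i,2*j+1)"
    using assms by (auto simp: mids_ok_def)
  show "D * u (2*i+1,2*j+1) = mid_val w M h h' u (2*i,2*j) (2*i+2,2*j) (2*i,2*j+2) (2*i+1,2*j+1) (2*i,2*j+1) (2*i+1,2*j)"
    unfolding D_def by (rule mid_solve[OF c0 holonomy_inverse(2) m(1) m(2) m(3)])
  show "D * u (2*i,2*j+1) = mid_val w M h h' u (2*i+2,2*j) (2*i,2*j+2) (2*i,2*j) (2*i,2*j+1) (2*i+1,2*j) (2*i+1,2*j+1)"
    unfolding D_def by (rule mid_solve[OF c1 holonomy_inverse(2) m(2) m(3) m(1)])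
  show "D * u (2*i+1,2*j) = mid_val w M h h' u (2*i,2*j+2) (2*i,2*j) (2*i+2,2*j) (2*i+1,2*j) (2*i+1,2*j+1) (2*i,2*j+1)"
    unfolding D_def by (rule mid_solve[OF c2 holonomy_inverse(2) m(3) m(1) m(2)])
qed

lemma mids_okI:
  assumes "D \<noteq> 0"
    and "D * u (2*i+1,2*j+1) = mid_val w M h h' u (2*i,2*j) (2*i+2,2*j) (2*i,2*j+2) (2*i+1,2*j+1) (2*i,2*j+1) (2*i+1,2*j)"
    and "D * u (2*i,2*j+1) = mid_val w M h h' u (2*i+2,2*j) (2*i,2*j+2) (2*i,2*j) (2*i,2*j+1) (2*i+1,2*j) (2*i+1,2*j+1)"
    and "D * u (2*i+1,2*j) = mid_val w M h h' u (2*i,2*j+2) (2*i,2*j) (2*i+2,2*j) (2*i+1,2*j) (2*i+1,2*j+1) (2*i,2*j+1)"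
  shows "mids_ok w M u i j"
proof -
  note c0 = conn_cell[OF w, folded g_def h_def, of i j]
  note c1 = cell_conn_rotate[OF c0]
  note c2 = cell_conn_rotate[OF c1]
  note a = assms[unfolded D_def]
  show ?thesis
    unfolding mids_ok_def
    using mid_val_mid_eq[OF c0 holonomy_inverse(2) a(1,2,3,4)]
      mid_val_mid_eq[OF c1 holonomy_inverse(2) a(1,3,4,2)]
      mid_val_mid_eq[OF c2 holonomy_inverse(2) a(1,4,2,3)] by blast
qed

lemma restrict_even_in_reduced:
  assumes "u \<in> mag_eigenspace (Suc n) w lam"
  shows "restrict_even u \<in> reduced_eigenspace n"
proof -
  note u = assms[unfolded mag_eigenspace_Suc_iff, folded M_def]
  have "(\<Sum>y\<in>sg_nbrs n (i,j). reduced_conn w e e' (i,j) y * u (2 * fst y, 2 * snd y))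
        = (D * of_real (1 - lam) - d / 2) * of_nat (sg_deg n (i,j)) * u (2*i,2*j)"
    if "(i,j) \<in> sg_verts n" for i j
  proof -
    have S: "(\<Sum>y\<in>sg_nbrs (Suc n) (2*i,2*j). w (2*i,2*j) y * u y) =
        of_real (1 - lam) * of_nat (sg_deg n (i,j)) * u (2*i,2*j)"
      using u that by blast
    have "\<forall>(i,j)\<in>sg_cells n. mids_ok w M u i j" using u by blast
    from corner_reduction[OF this, of i j] show ?thesis
      unfolding S by (simp add: algebra_simps)
  qed
  then show ?thesis
    using u by (auto simp: reduced_eigenspace_def sg_verts_Suc_iff)
qed

text \<open>The midpoint values of a cell are \<open>mid_val\<close> of its corner values divided by
  \<open>D\<close>, and everything outside the graph is zero.\<close>

lemma inj_on_restrict_even: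
  assumes D: "D \<noteq> 0"
  shows "inj_on restrict_even (mag_eigenspace (Suc n) w lam)"
proof (rule inj_onI)
  fix u v assume "u \<in> mag_eigenspace (Suc n) w lam" "v \<in> mag_eigenspace (Suc n) w lam"
    and eq: "restrict_even u = restrict_even v"
  note u = \<open>u \<in> _\<close>[unfolded mag_eigenspace_Suc_iff, folded M_def]
   and v = \<open>v \<in> _\<close>[unfolded mag_eigenspace_Suc_iff, folded M_def]
  have even: "u (2*i,2*j) = v (2*i,2*j)" for i j
    using fun_cong[OF eq, of "(i,j)"] by simp
  have corners: "u (2*i+2,2*j) = v (2*i+2,2*j)" "u (2*i,2*j+2) = v (2*i,2*j+2)" for i j
    using even[of "i+1" j] even[of i "j+1"] by (simp_all add: algebra_simps)
  have mid: "u (2*i+1,2*j+1) = v (2*i+1,2*j+1) \<and> u (2*i,2*j+1) = v (2*i,2*j+1) \<and> u (2*i+1,2*j) = v (2*i+1,2*j)" for i j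
  proof (cases "(i,j) \<in> sg_cells n")
    case True
    then have mu: "mids_ok w M u i j" and mv: "mids_ok w M v i j" using u v by blast+
    have "D * u (2*i+1,2*j+1) = D * v (2*i+1,2*j+1)" "D * u (2*i,2*j+1) = D * v (2*i,2*j+1)"
      "D * u (2*i+1,2*j) = D * v (2*i+1,2*j)"
      unfolding mids_ok_solve[OF mu] mids_ok_solve[OF mv] mid_val_def even corners by (rule refl)+
    then show ?thesis using D by simp
  next
    case False
    then show ?thesis using u v by (simp add: sg_verts_Suc_iff)
  qed
  show "u = v"
  proof
    fix x show "u x = v x"
      by (cases x rule: pt_parity_cases) (simp_all add: even mid)
  qed
qed

lemma reduced_in_restrict_even:
  assumes D: "D \<noteq> 0" and v: "v \<in> reduced_eigenspace n"
  shows "v \<in> restrict_even ` mag_eigenspace (Suc n) w lam"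
proof -
  \<comment> \<open>\<open>mid_val\<close> reads its function only at the even corners, where
    \<open>c\<close> is \<open>v\<close>; the values of \<open>c\<close> elsewhere are
    arbitrary.\<close>
  define c where "c = (\<lambda>(a,b). v (a div 2, b div 2))"
  define u where "u = (\<lambda>(a,b). let i = a div 2; j = b div 2 in
     if even a \<and> even b then v (i,j) else if (i,j) \<notin> sg_cells n then 0 else
     (if odd a \<and> odd b then mid_val w M h h' c (2*i,2*j) (2*i+2,2*j) (2*i,2*j+2) (2*i+1,2*j+1) (2*i,2*j+1) (2*i+1,2*j)
      else if odd b then mid_val w M h h' c (2*i+2,2*j) (2*i,2*j+2) (2*i,2*j) (2*i,2*j+1) (2*i+1,2*j) (2*i+1,2*j+1)
      else mid_val w M h h' c (2*i,2*j+2) (2*i,2*j) (2*i+2,2*j) (2*i+1,2*j) (2*i+1,2*j+1) (2*i,2*j+1)) / D)"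
  have even: "u (2*i,2*j) = v (i,j)" for i j
    by (simp add: u_def)
  have corners: "u (2*i+2,2*j) = v (i+1,j)" "u (2*i,2*j+2) = v (i,j+1)" for i j
    using even[of "i+1" j] even[of i "j+1"] by (simp_all add: algebra_simps)
  have c: "c (2*i,2*j) = v (i,j)" "c (2*i+2,2*j) = v (i+1,j)" "c (2*i,2*j+2) = v (i,j+1)" for i j
    by (simp_all add: c_def)
  have mids: "mids_ok w M u i j" if "(i,j) \<in> sg_cells n" for i j
  proof (rule mids_okI[OF D])
    show "D * u (2*i+1,2*j+1) = mid_val w M h h' u (2*i,2*j) (2*i+2,2*j) (2*i,2*j+2) (2*i+1,2*j+1) (2*i,2*j+1) (2*i+1,2*j)"
      unfolding mid_val_def even corners using that D by (simp add: u_def mid_val_def c)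
    show "D * u (2*i,2*j+1) = mid_val w M h h' u (2*i+2,2*j) (2*i,2*j+2) (2*i,2*j) (2*i,2*j+1) (2*i+1,2*j) (2*i+1,2*j+1)"
      unfolding mid_val_def even corners using that D by (simp add: u_def mid_val_def c)
    show "D * u (2*i+1,2*j) = mid_val w M h h' u (2*i,2*j+2) (2*i,2*j) (2*i+2,2*j) (2*i+1,2*j) (2*i+1,2*j+1) (2*i,2*j+1)"
      unfolding mid_val_def even corners using that D by (simp add: u_def mid_val_def c)
  qed
  have "u \<in> mag_eigenspace (Suc n) w lam"
    unfolding mag_eigenspace_Suc_iff M_def[symmetric]
  proof (intro conjI allI impI ballI)
    fix x assume "x \<notin> sg_verts (Suc n)"
    then show "u x = 0"
      using v by (cases x rule: pt_parity_cases) (simp_all add: sg_verts_Suc_iff reduced_eigenspace_def u_def)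
  next
    fix x assume "x \<in> sg_cells n"
    then show "case x of (i,j) \<Rightarrow> mids_ok w M u i j" using mids by (cases x) simp
  next
    fix x assume x: "x \<in> sg_verts n"
    obtain i j where ij: "x = (i,j)" by (cases x)
    have "(\<Sum>y\<in>sg_nbrs n (i,j). reduced_conn w e e' (i,j) y * u (2 * fst y, 2 * snd y))
        = (D * of_real (1 - lam) - d / 2) * of_nat (sg_deg n (i,j)) * u (2*i,2*j)"
      using v x by (simp add: reduced_eigenspace_def even ij)
    moreover have "D * (\<Sum>y\<in>sg_nbrs (Suc n) (2*i,2*j). w (2*i,2*j) y * u y) =
      d * (of_nat (sg_deg n (i,j)) / 2) * u (2*i,2*j)
      + (\<Sum>y\<in>sg_nbrs n (i,j). reduced_conn w e e' (i,j) y * u (2 * fst y, 2 * snd y))"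
      by (rule corner_reduction) (use mids in blast)
    ultimately have "D * (\<Sum>y\<in>sg_nbrs (Suc n) (2*i,2*j). w (2*i,2*j) y * u y) =
        D * (of_real (1 - lam) * of_nat (sg_deg n (i,j)) * u (2*i,2*j))"
      by (simp add: algebra_simps)
    then show "case x of (i,j) \<Rightarrow> (\<Sum>y\<in>sg_nbrs (Suc n) (2*i,2*j). w (2*i,2*j) y * u y) =
        of_real (1 - lam) * of_nat (sg_deg n (i,j)) * u (2*i,2*j)"
      using D by (simp add: ij)
  qed
  moreover have "v = restrict_even u" by (simp add: even)
  ultimately show ?thesis by blast
qed

lemma restrict_even_image:
  "D \<noteq> 0 \<Longrightarrow> restrict_even ` mag_eigenspace (Suc n) w lam = reduced_eigenspace n"
  using restrict_even_in_reduced reduced_in_restrict_even by blast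

lemma dim_mag_eigenspace_Suc:
  assumes "D \<noteq> 0"
  shows "cfun.dim (mag_eigenspace (Suc n) w lam) = cfun.dim (reduced_eigenspace n)"
  using cfun_dim_image[OF _ _ subspace_mag_eigenspace inj_on_restrict_even[OF assms]]
  by (simp add: restrict_even_image[OF assms] fun_eq_iff)

lemma mag_eigenspace_Suc_nontrivial_iff:
  assumes "D \<noteq> 0"
  shows "(\<exists>u\<in>mag_eigenspace (Suc n) w lam. u \<noteq> 0)
      \<longleftrightarrow> (\<exists>v\<in>reduced_eigenspace n. v \<noteq> 0)"
proof -
  have 0: "0 \<in> mag_eigenspace (Suc n) w lam" by (rule cfun.subspace_0[OF subspace_mag_eigenspace])
  have "restrict_even u = 0 \<longleftrightarrow> u = 0" if "u \<in> mag_eigenspace (Suc n) w lam" for u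
    using inj_onD[OF inj_on_restrict_even[OF assms] _ that 0] by (auto simp: zero_fun_def)
  then show ?thesis unfolding restrict_even_image[OF assms, symmetric] by auto
qed

end

section \<open>Holonomy of the reduced connection\<close>

lemma boundary_holonomy:
  assumes "cell_conn w g h p0 p1 p2 q0 q1 q2"
  shows "(w p0 q2 * w q2 p1) * (w p1 q0 * w q0 p2) * (w p2 q1 * w q1 p0) = g^3 * h"
proof -
  have inv: "w q0 q1 * w q1 q0 = 1" "w q1 q2 * w q2 q1 = 1" "w q2 q0 * w q0 q2 = 1"
   and hol: "w p0 q2 * w q2 q1 * w q1 p0 = g" "w p1 q0 * w q0 q2 * w q2 p1 = g"
    "w p2 q1 * w q1 q0 * w q0 p2 = g" "w q2 q0 * w q0 q1 * w q1 q2 = h"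
    using assms by (auto simp: cell_conn_def)
  \<comment> \<open>Multiplying the four unit loops runs through every inner edge once in each
    direction, so only the boundary remains.\<close>
  have "g^3 * h = (w p0 q2 * w q2 q1 * w q1 p0) * (w p1 q0 * w q0 q2 * w q2 p1) *
      (w p2 q1 * w q1 q0 * w q0 p2) * (w q2 q0 * w q0 q1 * w q1 q2)"
    unfolding hol by (simp add: power3_eq_cube)
  also have "\<dots> = (w p0 q2 * w q2 p1) * (w p1 q0 * w q0 p2) * (w p2 q1 * w q1 p0) *
      ((w q0 q1 * w q1 q0) * (w q1 q2 * w q2 q1) * (w q2 q0 * w q0 q2))"
    by (simp only: mult_ac)
  finally show ?thesis by (simp add: inv)
qed

text \<open>In a downward triangle of side 2 the corner triangles point down and the inner one up,
  so \<alpha> and \<beta> exchange roles.\<close>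

lemma conn_cell_down:
  assumes w: "unitary_connection w" "has_holonomy w \<alpha> \<beta>"
  shows "cell_conn w (cis (2*pi*\<beta>)) (cis (2*pi*\<alpha>))
     (2*i+2,2*j) (2*i+2,2*j+2) (2*i,2*j+2) (2*i+1,2*j+2) (2*i+1,2*j+1) (2*i+2,2*j+1)"
proof -
  note inv = unitary_connection_inverse[OF w(1)]
  have up: "w (a,b) (a+1,b) * w (a+1,b) (a,b+1) * w (a,b+1) (a,b) = cis (2*pi*\<alpha>)"
   and down: "w (a+1,b) (a+1,b+1) * w (a+1,b+1) (a,b+1) * w (a,b+1) (a+1,b) = cis (2*pi*\<beta>)" for a b
    using w(2) by (simp_all add: has_holonomy_def)
  show ?thesis
    unfolding cell_conn_def
    using up[of "2*i+1" "2*j+1"] down[of "2*i+1" "2*j"] down[of "2*i+1" "2*j+1"] down[of "2*i" "2*j+1"]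
    by (simp add: inv lat_adj_def add.commute mult_ac)
qed

lemma unitary_reduced_conn:
  assumes w: "unitary_connection w" and p: "cmod p = 1"
  shows "unitary_connection (reduced_conn w p (cnj p))"
  unfolding unitary_connection_def
proof (intro allI impI)
  fix x y assume xy: "lat_adj x y"
  obtain a b c d where x: "x = (a,b)" and y: "y = (c,d)" by (cases x, cases y)
  have "lat_adj (2*a,2*b) (a+c,b+d)" "lat_adj (a+c,b+d) (2*c,2*d)"
    using xy by (auto simp: x y lat_adj_def)
  then have *: "cmod (w (2*a,2*b) (a+c,b+d)) = 1" "w (a+c,b+d) (2*a,2*b) = cnj (w (2*a,2*b) (a+c,b+d))"
     "cmod (w (a+c,b+d) (2*c,2*d)) = 1" "w (2*c,2*d) (a+c,b+d) = cnj (w (a+c,b+d) (2*c,2*d))"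
    using w unfolding unitary_connection_def by blast+
  have eq: "c + a = a + c" "d + b = b + d" by simp_all
  show "cmod (reduced_conn w p (cnj p) x y) = 1 \<and>
      reduced_conn w p (cnj p) y x = cnj (reduced_conn w p (cnj p) x y)"
    using xy unfolding x y reduced_conn_def fst_conv snd_conv eq *(2,4)
    by (auto simp: norm_mult * p lat_adj_def)
qed

text \<open>Counterclockwise, an upward triangle uses the three directions that carry
  \<open>p\<close> and a downward one their reverses, which carry \<open>cnj p\<close>. The
  remaining factor is the boundary holonomy of a triangle of side 2.\<close>

lemma has_holonomy_reduced_conn:
  assumes w: "unitary_connection w" "has_holonomy w \<alpha> \<beta>"
    and \<alpha>': "cis (2*pi*\<alpha>') = p^3 * cis (2*pi*\<alpha>)^3 * cis (2*pi*\<beta>)"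
    and \<beta>': "cis (2*pi*\<beta>') = (cnj p)^3 * cis (2*pi*\<beta>)^3 * cis (2*pi*\<alpha>)"
  shows "has_holonomy (reduced_conn w p (cnj p)) \<alpha>' \<beta>'"
  unfolding has_holonomy_def
proof (intro conjI allI)
  fix i j :: int
  show "reduced_conn w p (cnj p) (i,j) (i+1,j) * reduced_conn w p (cnj p) (i+1,j) (i,j+1)
      * reduced_conn w p (cnj p) (i,j+1) (i,j) = cis (2*pi*\<alpha>')"
    using boundary_holonomy[OF conn_cell[OF w, of i j]] unfolding \<alpha>'
    by (simp add: reduced_conn_def power3_eq_cube) (simp add: algebra_simps)
  show "reduced_conn w p (cnj p) (i+1,j) (i+1,j+1) * reduced_conn w p (cnj p) (i+1,j+1) (i,j+1)
      * reduced_conn w p (cnj p) (i,j+1) (i+1,j) = cis (2*pi*\<beta>')"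
    using boundary_holonomy[OF conn_cell_down[OF w, of i j]] unfolding \<beta>'
    by (simp add: reduced_conn_def power3_eq_cube) (simp add: algebra_simps)
qed

section \<open>Identification of the coefficients and exceptional values\<close>

text \<open>
  Why \<open>M = - (g + g')\<close>: when the off-diagonal coefficients vanish, corner values are arbitrary, so some
  eigenfunction vanishes at two corners. The corner equations there make the three midpoint values determine
  each other, and the equation at the midpoint between these corners reads \<open>M = - (g + g')\<close>.
\<close>

lemma edge_coeffs_vanish:
  fixes M g g' h h' :: complex
  assumes "g * g' = 1" "h * h' = 1" "edge_coeff M g' h' = 0" "edge_coeff M g h = 0"
    and "M * mid_det M h h' = 2 * diag_coeff M g g' h h'"
  shows "mid_det M h h' * (M + g + g') = 0"
  using assms unfolding edge_coeff_def mid_det_def diag_coeff_def by algebra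

text \<open>Inserting \<open>M = - (g + g')\<close> factors the edge coefficient into
  \<open>1 - g^2\<close> and \<open>g'^2 + g*h\<close>, and the second factor cannot vanish while
  \<open>mid_det\<close> does not.\<close>

lemma edge_coeffs_vanish_cases:
  fixes M g g' h h' :: complex
  assumes gh: "g * g' = 1" "h * h' = 1" and e: "edge_coeff M g' h' = 0" "edge_coeff M g h = 0"
    and d: "M * mid_det M h h' = 2 * diag_coeff M g g' h h'" and D: "mid_det M h h' \<noteq> 0"
  shows "M = - (g + g')" "g^2 = 1"
proof -
  have "M + g + g' = 0"
    using edge_coeffs_vanish[OF gh e d] D by simp
  then show M: "M = - (g + g')" by algebra
  have "(1 - g^2) * (g'^2 + g*h) = 0"
    using e(2) gh unfolding edge_coeff_def M by algebra
  moreover have "g'^2 + g*h \<noteq> 0"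
  proof
    \<comment> \<open>Then \<open>h\<close> is the negative cube of \<open>g'\<close> and
      \<open>h'\<close> that of \<open>g\<close>, and the determinant collapses by expanding the
      cube of \<open>g + g'\<close>.\<close>
    assume "g'^2 + g*h = 0"
    then have "mid_det M h h' = 0"
      using gh unfolding mid_det_def M by algebra
    then show False using D by simp
  qed
  ultimately show "g^2 = 1" by simp
qed

lemma cis_double_eq_1_cases:
  assumes "cis (2*pi*\<alpha>)^2 = 1" "0 \<le> \<alpha>" "\<alpha> < 1"
  shows "\<alpha> = 0 \<or> \<alpha> = 1/2"
proof -
  have "cis (4*pi*\<alpha>) = 1" using assms(1) by (simp add: power2_eq_square cis_mult mult.assoc)
  then have "cos (4*pi*\<alpha>) = 1" by (simp add: complex_eq_iff)
  then obtain n :: int where "4*pi*\<alpha> = of_int n * 2 * pi"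
    using cos_one_2pi_int by blast
  then have n: "of_int n = 2 * \<alpha>" by simp
  then have "0 \<le> n" "n < 2" using assms(2,3) by linarith+
  then have "n = 0 \<or> n = 1" by linarith
  then show ?thesis using n by auto
qed

lemma arg02pi_cis: "z \<noteq> 0 \<Longrightarrow> cis (arg02pi z) = z / of_real (cmod z)"
  using cis_Arg[of z] by (simp add: arg02pi_def sgn_eq flip: cis_mult)

lemma cis_2pi_frac: "cis (2 * pi * frac x) = cis (2 * pi * x)"
proof -
  have "cis (2 * pi * frac x) = cis (2 * pi * x) * cis (- (2 * pi * of_int \<lfloor>x\<rfloor>))"
    by (simp add: frac_def cis_mult algebra_simps)
  also have "cis (- (2 * pi * of_int \<lfloor>x\<rfloor>)) = 1"
    by (simp flip: cis_cnj)
  finally show ?thesis by simp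
qed

lemma cis_cube: "cis x ^ 3 = cis (3 * x)"
  by (simp add: power3_eq_cube cis_mult)

lemma sg_verts_nonempty: "sg_verts n \<noteq> {}"
  using card_sg_verts[of n] by auto

lemma mult_L_eq: "mult_L n \<alpha> \<beta> lam = cfun.dim (mag_eigenspace n (mag_conn \<alpha> \<beta>) lam)"
  by (simp add: mult_L_def eigenspace_L_eq)

lemma spec_L_iff: "lam \<in> spec_L n \<alpha> \<beta>
    \<longleftrightarrow> (\<exists>u\<in>mag_eigenspace n (mag_conn \<alpha> \<beta>) lam. u \<noteq> 0)"
  by (simp add: spec_L_def eigenspace_L_eq zero_fun_def)

context decimation begin

lemma cnj_holonomies: "cnj g = g'" "cnj h = h'" "cnj g' = g" "cnj h' = h" "cnj M = M"
  by (simp_all add: g_def g'_def h_def h'_def M_def cis_cnj)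

lemma D_eq: "D = of_real (64 * D_fn \<beta> lam)"
proof -
  have "h + h' = of_real (2 * cos (2*pi*\<beta>))"
    by (simp add: h_def h'_def complex_eq_iff)
  then have "D = of_real ((4 * (1 - lam))^3 - 3 * (4 * (1 - lam)) - 2 * cos (2*pi*\<beta>))"
    unfolding D_def mid_det_def M_def diff_diff_eq[of _ h] by simp
  also have "(4 * (1 - lam))^3 - 3 * (4 * (1 - lam)) - 2 * cos (2*pi*\<beta>) = 64 * D_fn \<beta> lam"
    by (simp add: D_fn_def power3_eq_cube power2_eq_square algebra_simps)
  finally show ?thesis .
qed

lemma d_eq: "d = of_real (2 * A_fn \<alpha> \<beta> lam)"
proof -
  have g: "g + g' = of_real (2 * cos (2*pi*\<alpha>))"
    by (simp add: g_def g'_def complex_eq_iff)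
  have "g * h = cis (2*pi*(\<alpha>+\<beta>))" "g' * h' = cis (- (2*pi*(\<alpha>+\<beta>)))"
    by (simp_all add: g_def g'_def h_def h'_def cis_mult algebra_simps)
  then have gh: "g * h + g' * h' = of_real (2 * cos (2*pi*(\<alpha>+\<beta>)))"
    by (simp add: complex_eq_iff)
  have "d = 2 * (M^2 - 1) + M * (g + g') + (g * h + g' * h')"
    unfolding d_def diag_coeff_def by (simp add: algebra_simps)
  also have "\<dots> = of_real (2 * ((4 * (1 - lam))^2 - 1) + 4 * (1 - lam) * (2 * cos (2*pi*\<alpha>)) + 2 * cos (2*pi*(\<alpha>+\<beta>)))"
    unfolding g gh M_def by simp
  also have "2 * ((4 * (1 - lam))^2 - 1) + 4 * (1 - lam) * (2 * cos (2*pi*\<alpha>)) + 2 * cos (2*pi*(\<alpha>+\<beta>))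
      = 2 * A_fn \<alpha> \<beta> lam"
    by (simp add: A_fn_def power2_eq_square algebra_simps)
  finally show ?thesis .
qed

lemma e_eq: "e = 16 * Psi_fn \<alpha> \<beta> lam"
proof -
  have "cis (-2*pi*\<alpha>) = g'" "cis (-2*pi*(2*\<alpha>+\<beta>)) = g'^2 * h'" "cis (-4*pi*\<alpha>) = g'^2"
      "cis (-2*pi*(\<alpha>+\<beta>)) = g' * h'"
    by (simp_all add: g'_def h'_def power2_eq_square cis_mult algebra_simps add.commute)
  then show ?thesis
    unfolding e_def edge_coeff_def Psi_fn_def M_def
    by (simp add: field_simps power2_eq_square)
qed

lemma e'_eq: "e' = cnj e"
  by (simp add: e_def e'_def edge_coeff_def cnj_holonomies)

text \<open>Dividing by 16 times the modulus of \<open>Psi_fn\<close> leaves the unit phase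
  \<open>p\<close> on the edges, and \<open>R_fn\<close> is defined so that the diagonal becomes
  \<open>1 - R_fn\<close>.\<close>

lemma reduced_eigenspace_eq:
  assumes Psi: "Psi_fn \<alpha> \<beta> lam \<noteq> 0"
  defines "p \<equiv> cis (2 * pi * theta_fn \<alpha> \<beta> lam)"
  shows "reduced_eigenspace n = mag_eigenspace n (reduced_conn w p (cnj p)) (R_fn \<alpha> \<beta> lam)"
proof -
  let ?c = "complex_of_real (16 * cmod (Psi_fn \<alpha> \<beta> lam))"
  have c: "?c \<noteq> 0" using Psi by simp
  have "p = Psi_fn \<alpha> \<beta> lam / of_real (cmod (Psi_fn \<alpha> \<beta> lam))"
    using arg02pi_cis[OF Psi] by (simp add: p_def theta_fn_def)
  then have e: "e = ?c * p" using Psi by (simp add: e_eq)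
  then have e': "e' = ?c * cnj p" by (simp add: e'_eq)
  have r: "reduced_conn w e e' x y = ?c * reduced_conn w p (cnj p) x y" for x y
    unfolding reduced_conn_def e e' by simp
  have k: "D * of_real (1 - lam) - d / 2 = ?c * of_real (1 - R_fn \<alpha> \<beta> lam)"
  proof -
    have "64 * D_fn \<beta> lam * (1 - lam) - A_fn \<alpha> \<beta> lam
        = 16 * cmod (Psi_fn \<alpha> \<beta> lam) * (1 - R_fn \<alpha> \<beta> lam)"
      using Psi by (simp add: R_fn_def)
    then show ?thesis
      unfolding D_eq d_eq
      by (metis (no_types) nonzero_mult_div_cancel_left of_real_diff of_real_mult of_real_numeral zero_neq_numeral)
  qed
  have "(\<Sum>y\<in>sg_nbrs n x. reduced_conn w e e' x y * v y) = (D * of_real (1 - lam) - d / 2) * of_nat (sg_deg n x) * v x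
    \<longleftrightarrow> (\<Sum>y\<in>sg_nbrs n x. reduced_conn w p (cnj p) x y * v y)
        = of_real (1 - R_fn \<alpha> \<beta> lam) * of_nat (sg_deg n x) * v x"
    for v x
    unfolding r k mult.assoc sum_distrib_left[symmetric] using c by simp
  then show ?thesis
    by (simp add: reduced_eigenspace_def mag_eigenspace_def)
qed

text \<open>Without edge terms, one scalar decides: if it is zero the equations are void, otherwise
  they force every value to vanish, as degrees are positive.\<close>

lemma reduced_eigenspace_Psi_zero:
  assumes Psi: "Psi_fn \<alpha> \<beta> lam = 0"
  shows "reduced_eigenspace n = (if 64 * D_fn \<beta> lam * (1 - lam) = A_fn \<alpha> \<beta> lam
     then {v. \<forall>x. x \<notin> sg_verts n \<longrightarrow> v x = 0} else {0})"
proof -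
  have "e = 0" "e' = 0" using Psi by (simp_all add: e_eq e'_eq)
  then have r: "reduced_conn w e e' x y = 0" for x y by (simp add: reduced_conn_def)
  have k: "D * of_real (1 - lam) - d / 2 = of_real (64 * D_fn \<beta> lam * (1 - lam) - A_fn \<alpha> \<beta> lam)"
    unfolding D_eq d_eq by simp
  have "(\<Sum>y\<in>sg_nbrs n x. 0 * v y)
      = of_real (64 * D_fn \<beta> lam * (1 - lam) - A_fn \<alpha> \<beta> lam) * of_nat (sg_deg n x) * v x
      \<longleftrightarrow> 64 * D_fn \<beta> lam * (1 - lam) = A_fn \<alpha> \<beta> lam \<or> v x = 0"
      if "x \<in> sg_verts n" for v :: "pt \<Rightarrow> complex" and x
    using sg_deg_pos[OF that] by (auto simp del: of_real_diff)
  then have E: "v \<in> reduced_eigenspace n \<longleftrightarrow> (\<forall>x. x \<notin> sg_verts n \<longrightarrow> v x = 0) \<and>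
      (\<forall>x\<in>sg_verts n. 64 * D_fn \<beta> lam * (1 - lam) = A_fn \<alpha> \<beta> lam \<or> v x = 0)" for v
    unfolding reduced_eigenspace_def r k by blast
  show ?thesis
    by (rule set_eqI) (auto simp: E fun_eq_iff)
qed

text \<open>The reduced connection has the holonomies of \<open>alpha_down\<close> and
  \<open>beta_down\<close>, since \<open>frac\<close> drops only full turns. Gauge equivalence then
  replaces it by \<open>mag_conn\<close>.\<close>

lemma regular_decimation:
  assumes D: "D_fn \<beta> lam \<noteq> 0" and Psi: "Psi_fn \<alpha> \<beta> lam \<noteq> 0"
  shows "cfun.dim (mag_eigenspace (Suc n) w lam)
      = mult_L n (alpha_down \<alpha> \<beta> lam) (beta_down \<alpha> \<beta> lam) (R_fn \<alpha> \<beta> lam)"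
    and "(\<exists>u\<in>mag_eigenspace (Suc n) w lam. u \<noteq> 0)
      \<longleftrightarrow> R_fn \<alpha> \<beta> lam \<in> spec_L n (alpha_down \<alpha> \<beta> lam) (beta_down \<alpha> \<beta> lam)"
proof -
  define p where "p = cis (2 * pi * theta_fn \<alpha> \<beta> lam)"
  have p: "cmod p = 1" "cnj p = cis (- 2 * pi * theta_fn \<alpha> \<beta> lam)"
    by (simp_all add: p_def cis_cnj)
  have "cis (2 * pi * alpha_down \<alpha> \<beta> lam) = p^3 * cis (2*pi*\<alpha>)^3 * cis (2*pi*\<beta>)"
    by (simp add: alpha_down_def cis_2pi_frac p_def cis_cube cis_mult) (simp add: algebra_simps)
  moreover have "cis (2 * pi * beta_down \<alpha> \<beta> lam) = (cnj p)^3 * cis (2*pi*\<beta>)^3 * cis (2*pi*\<alpha>)"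
    unfolding p(2) by (simp add: beta_down_def cis_2pi_frac cis_cube cis_mult) (simp add: algebra_simps)
  ultimately have hol: "has_holonomy (reduced_conn w p (cnj p)) (alpha_down \<alpha> \<beta> lam) (beta_down \<alpha> \<beta> lam)"
    by (rule has_holonomy_reduced_conn[OF w])
  note gauge = gauge_equivalent[OF unitary_reduced_conn[OF w(1) p(1)] hol mag_conn, of n "R_fn \<alpha> \<beta> lam"]
  have D0: "D \<noteq> 0" using D by (simp add: D_eq)
  note red = reduced_eigenspace_eq[OF Psi, folded p_def, of n]
  show "cfun.dim (mag_eigenspace (Suc n) w lam)
      = mult_L n (alpha_down \<alpha> \<beta> lam) (beta_down \<alpha> \<beta> lam) (R_fn \<alpha> \<beta> lam)"
    unfolding dim_mag_eigenspace_Suc[OF D0] red gauge(1) mult_L_eq ..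
  show "(\<exists>u\<in>mag_eigenspace (Suc n) w lam. u \<noteq> 0)
      \<longleftrightarrow> R_fn \<alpha> \<beta> lam \<in> spec_L n (alpha_down \<alpha> \<beta> lam) (beta_down \<alpha> \<beta> lam)"
    unfolding mag_eigenspace_Suc_nontrivial_iff[OF D0] red gauge(2) spec_L_iff ..
qed

lemma exceptional_decimation:
  assumes D: "D_fn \<beta> lam \<noteq> 0" and Psi: "Psi_fn \<alpha> \<beta> lam = 0"
  shows "(\<exists>u\<in>mag_eigenspace (Suc n) w lam. u \<noteq> 0)
      \<longleftrightarrow> 64 * D_fn \<beta> lam * (1 - lam) = A_fn \<alpha> \<beta> lam"
    and "64 * D_fn \<beta> lam * (1 - lam) = A_fn \<alpha> \<beta> lam \<Longrightarrow>
      cfun.dim (mag_eigenspace (Suc n) w lam) = card (sg_verts n)"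
proof -
  have D0: "D \<noteq> 0" using D by (simp add: D_eq)
  obtain x0 where x0: "x0 \<in> sg_verts n" using sg_verts_nonempty by blast
  let ?d = "\<lambda>x. if x = x0 then 1 else 0 :: complex"
  have "?d \<in> {v. \<forall>x. x \<notin> sg_verts n \<longrightarrow> v x = 0}" using x0 by auto
  moreover have "?d \<noteq> 0"
  proof
    assume "?d = 0"
    from fun_cong[OF this, of x0] show False by simp
  qed
  ultimately have ne: "\<exists>v\<in>{v :: pt \<Rightarrow> complex. \<forall>x. x \<notin> sg_verts n \<longrightarrow> v x = 0}. v \<noteq> 0" by blast
  show "(\<exists>u\<in>mag_eigenspace (Suc n) w lam. u \<noteq> 0)
      \<longleftrightarrow> 64 * D_fn \<beta> lam * (1 - lam) = A_fn \<alpha> \<beta> lam"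
    unfolding mag_eigenspace_Suc_nontrivial_iff[OF D0] reduced_eigenspace_Psi_zero[OF Psi] using ne by simp
  show "cfun.dim (mag_eigenspace (Suc n) w lam) = card (sg_verts n)"
    if "64 * D_fn \<beta> lam * (1 - lam) = A_fn \<alpha> \<beta> lam"
    unfolding dim_mag_eigenspace_Suc[OF D0] reduced_eigenspace_Psi_zero[OF Psi]
    using that cfun_dim_supported[OF finite_sg_verts] by simp
qed

text \<open>The hypothesis on \<open>A_fn\<close> is the equation \<open>M * D = 2 * d\<close>, so
  \<open>edge_coeffs_vanish_cases\<close> applies: the square of \<open>g\<close> is 1, which leaves
  two values of \<alpha>, and \<open>M = - (g + g')\<close> then determines
  \<open>lam\<close>.\<close>

lemma exceptional_imp:
  assumes D: "D_fn \<beta> lam \<noteq> 0" and Psi: "Psi_fn \<alpha> \<beta> lam = 0"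
    and A: "64 * D_fn \<beta> lam * (1 - lam) = A_fn \<alpha> \<beta> lam" and \<alpha>: "0 \<le> \<alpha>" "\<alpha> < 1"
  shows "\<alpha> = 0 \<and> lam = 3/2 \<or> \<alpha> = 1/2 \<and> lam = 1/2"
proof -
  have "M * D = of_real (4 * (64 * D_fn \<beta> lam * (1 - lam)))"
    by (simp add: D_eq M_def)
  also have "\<dots> = 2 * d" unfolding A d_eq by simp
  finally have "M * mid_det M h h' = 2 * diag_coeff M g g' h h'"
    by (simp add: D_def d_def)
  moreover have "edge_coeff M g' h' = 0" "edge_coeff M g h = 0"
    using Psi e_eq e'_eq by (simp_all add: e_def e'_def)
  moreover have "mid_det M h h' \<noteq> 0" using D D_eq by (simp add: D_def)
  ultimately have M: "M = - (g + g')" and g: "g^2 = 1"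
    using edge_coeffs_vanish_cases[OF holonomy_inverse] by blast+
  have "M = of_real (- 2 * cos (2*pi*\<alpha>))"
    unfolding M by (simp add: g_def g'_def complex_eq_iff)
  then have "4 * (1 - lam) = - 2 * cos (2*pi*\<alpha>)"
    unfolding M_def of_real_eq_iff .
  moreover have "\<alpha> = 0 \<or> \<alpha> = 1/2"
    using cis_double_eq_1_cases[OF _ \<alpha>] g by (simp add: g_def)
  ultimately show ?thesis by (elim disjE) simp_all
qed

end

section \<open>The exceptional eigenvalues 3/2 and 1/2\<close>

lemma cos_2pi_eq_neg1_imp:
  assumes "cos (2*pi*\<beta>) = -1" "0 \<le> \<beta>" "\<beta> < 1"
  shows "\<beta> = 1/2"
proof -
  have "cis (2*pi*\<beta>) = -1"
    using assms(1) sin_cos_squared_add[of "2*pi*\<beta>"] by (simp add: complex_eq_iff)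
  then have "cis (2*pi*\<beta>)^2 = 1" by simp
  then show ?thesis using cis_double_eq_1_cases[of \<beta>] assms by auto
qed

lemma cos_2pi_eq_1_imp:
  assumes "cos (2*pi*\<beta>) = 1" "0 \<le> \<beta>" "\<beta> < 1"
  shows "\<beta> = 0"
proof -
  have "cis (2*pi*\<beta>) = 1"
    using assms(1) sin_cos_squared_add[of "2*pi*\<beta>"] by (simp add: complex_eq_iff)
  then have "cis (2*pi*\<beta>)^2 = 1" by simp
  moreover have "\<beta> \<noteq> 1/2"
  proof
    assume "\<beta> = 1/2"
    with assms(1) show False by simp
  qed
  ultimately show ?thesis using cis_double_eq_1_cases[of \<beta>] assms by blast
qed

text \<open>At 3/2 the value of \<open>D_fn\<close> is
  \<open>- (1 + cos (2*pi*\<beta>)) / 32\<close>, which is zero only for \<beta> = 1/2.\<close>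

lemma exceptional_values_0:
  assumes "0 \<le> \<beta>" "\<beta> < 1" "\<beta> \<noteq> 1/2"
  shows "D_fn \<beta> (3/2) \<noteq> 0" "Psi_fn 0 \<beta> (3/2) = 0" "64 * D_fn \<beta> (3/2) * (1 - 3/2) = A_fn 0 \<beta> (3/2)"
proof -
  show "D_fn \<beta> (3/2) \<noteq> 0"
    using cos_2pi_eq_neg1_imp[of \<beta>] assms by (auto simp: D_fn_def power2_eq_square power3_eq_cube)
  show "Psi_fn 0 \<beta> (3/2) = 0"
    by (simp add: Psi_fn_def power2_eq_square field_simps)
  show "64 * D_fn \<beta> (3/2) * (1 - 3/2) = A_fn 0 \<beta> (3/2)"
    by (simp add: A_fn_def D_fn_def power2_eq_square power3_eq_cube field_simps)
qed

text \<open>At 1/2 the value of \<open>D_fn\<close> is \<open>(1 - cos (2*pi*\<beta>)) / 32\<close>,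
  which is zero only for \<beta> = 0.\<close>

lemma exceptional_values_half:
  assumes "0 \<le> \<beta>" "\<beta> < 1" "\<beta> \<noteq> 0"
  shows "D_fn \<beta> (1/2) \<noteq> 0" "Psi_fn (1/2) \<beta> (1/2) = 0" "64 * D_fn \<beta> (1/2) * (1 - 1/2) = A_fn (1/2) \<beta> (1/2)"
proof -
  show "D_fn \<beta> (1/2) \<noteq> 0"
    using cos_2pi_eq_1_imp[of \<beta>] assms by (auto simp: D_fn_def power2_eq_square power3_eq_cube)
  have "cis (- 2 * pi * (1 / 2)) = -1" "cis (- 4 * pi * (1 / 2)) = 1"
     "cis (- 2 * pi * (2 * (1 / 2) + \<beta>)) = cis (- (2 * pi * \<beta>))"
     "cis (- 2 * pi * (1 / 2 + \<beta>)) = - cis (- (2 * pi * \<beta>))"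
    by (simp_all add: complex_eq_iff distrib_left cos_add sin_add cos_diff sin_diff)
  then show "Psi_fn (1/2) \<beta> (1/2) = 0"
    unfolding Psi_fn_def by (simp add: power2_eq_square field_simps)
  have "cos (2 * pi * (1/2 + \<beta>)) = - cos (2 * pi * \<beta>)" "cos (2 * pi * (1/2)) = -1"
    by (simp_all add: distrib_left cos_add)
  then show "64 * D_fn \<beta> (1/2) * (1 - 1/2) = A_fn (1/2) \<beta> (1/2)"
    unfolding A_fn_def D_fn_def by (simp add: power2_eq_square power3_eq_cube)
qed

section \<open>Decomposition of the spectrum\<close>

theorem theorem1p5:
  fixes \<alpha> \<beta> :: real and N :: nat
  assumes "0 \<le> \<alpha>" "\<alpha> < 1" "0 \<le> \<beta>" "\<beta> < 1"
    and "\<not> (\<alpha> \<in> {0, 1/2} \<and> \<beta> \<in> {0, 1/2})"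
    and "N \<ge> 1"
  defines "S1 \<equiv> {lam. lam \<notin> exc_set \<alpha> \<beta> \<and>
                 R_fn \<alpha> \<beta> lam \<in> spec_L (N-1) (alpha_down \<alpha> \<beta> lam) (beta_down \<alpha> \<beta> lam)}"
    and "S2 \<equiv> {lam. D_fn \<beta> lam = 0 \<and> lam \<in> spec_L N \<alpha> \<beta>}"
    and "S3 \<equiv> (if \<alpha> = 0 then {3/2} else if \<alpha> = 1/2 then {1/2} else ({} :: real set))"
  shows "spec_L N \<alpha> \<beta> = S1 \<union> S2 \<union> S3
    \<and> S1 \<inter> S2 = {} \<and> S1 \<inter> S3 = {} \<and> S2 \<inter> S3 = {}
    \<and> (\<forall>lam\<in>S1. mult_L N \<alpha> \<beta> lam =
          mult_L (N-1) (alpha_down \<alpha> \<beta> lam) (beta_down \<alpha> \<beta> lam) (R_fn \<alpha> \<beta> lam))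
    \<and> (\<forall>lam\<in>S3. real (mult_L N \<alpha> \<beta> lam) = (3^N + 3) / 2)"
proof -
  obtain n where N: "N = Suc n" using \<open>N \<ge> 1\<close> by (cases N) auto
  have dec: "decimation (mag_conn \<alpha> \<beta>) \<alpha> \<beta>"
    by unfold_locales (rule mag_conn)+
  have regular: "mult_L N \<alpha> \<beta> lam
      = mult_L n (alpha_down \<alpha> \<beta> lam) (beta_down \<alpha> \<beta> lam) (R_fn \<alpha> \<beta> lam)"
      "lam \<in> spec_L N \<alpha> \<beta>
          \<longleftrightarrow> R_fn \<alpha> \<beta> lam \<in> spec_L n (alpha_down \<alpha> \<beta> lam) (beta_down \<alpha> \<beta> lam)"
    if "lam \<notin> exc_set \<alpha> \<beta>" for lam
    using decimation.regular_decimation[OF dec] that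
    by (simp_all add: N exc_set_def mult_L_eq[of "Suc n"] spec_L_iff[of _ "Suc n"])
  \<comment> \<open>This turns the explicit \<open>S3\<close> into a condition on
    \<open>D_fn\<close> and \<open>Psi_fn\<close>, so that disjointness and covering become a case
    distinction on their zeros. The restriction on the pair \<alpha>, \<beta> enters here, to keep
    \<open>D_fn\<close> nonzero on \<open>S3\<close>.\<close>
  have S3_iff: "lam \<in> S3 \<longleftrightarrow> D_fn \<beta> lam \<noteq> 0 \<and> Psi_fn \<alpha> \<beta> lam
      = 0 \<and> 64 * D_fn \<beta> lam * (1 - lam) = A_fn \<alpha> \<beta> lam" for lam
  proof
    assume "lam \<in> S3"
    then consider "\<alpha> = 0" "lam = 3/2" | "\<alpha> = 1/2" "lam = 1/2"
      by (auto simp: S3_def split: if_splits)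
    then show "D_fn \<beta> lam \<noteq> 0 \<and> Psi_fn \<alpha> \<beta> lam
        = 0 \<and> 64 * D_fn \<beta> lam * (1 - lam) = A_fn \<alpha> \<beta> lam"
    proof cases
      case 1
      then have "\<beta> \<noteq> 1/2" using assms(5) by blast
      from exceptional_values_0[OF assms(3,4) this] show ?thesis unfolding 1 by blast
    next
      case 2
      then have "\<beta> \<noteq> 0" using assms(5) by blast
      from exceptional_values_half[OF assms(3,4) this] show ?thesis unfolding 2 by blast
    qed
  next
    assume "D_fn \<beta> lam \<noteq> 0 \<and> Psi_fn \<alpha> \<beta> lam
        = 0 \<and> 64 * D_fn \<beta> lam * (1 - lam) = A_fn \<alpha> \<beta> lam"
    then have "\<alpha> = 0 \<and> lam = 3/2 \<or> \<alpha> = 1/2 \<and> lam = 1/2"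
      using decimation.exceptional_imp[OF dec] assms(1,2) by blast
    then show "lam \<in> S3" by (auto simp: S3_def)
  qed
  have exceptional: "lam \<in> spec_L N \<alpha> \<beta> \<longleftrightarrow> lam \<in> S3" if
      "D_fn \<beta> lam \<noteq> 0" "Psi_fn \<alpha> \<beta> lam = 0" for lam
    using decimation.exceptional_decimation(1)[OF dec that, of n] that by (simp add: N spec_L_iff S3_iff)
  have mult: "real (mult_L N \<alpha> \<beta> lam) = (3^N + 3) / 2" if "lam \<in> S3" for lam
  proof -
    have "mult_L N \<alpha> \<beta> lam = card (sg_verts n)"
      using decimation.exceptional_decimation(2)[OF dec, of lam n] that by (simp add: N mult_L_eq S3_iff)
    moreover have "real (2 * card (sg_verts n)) = 3^N + 3"
      unfolding card_sg_verts N by simp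
    ultimately show ?thesis by simp
  qed
  have "lam \<in> spec_L N \<alpha> \<beta> \<longleftrightarrow> lam \<in> S1 \<union> S2 \<union> S3" for lam
  proof (cases "lam \<in> exc_set \<alpha> \<beta>")
    case False
    then show ?thesis using regular(2)[OF False] by (auto simp: S1_def S2_def S3_iff exc_set_def N)
  next
    case True
    then show ?thesis using exceptional[of lam]
      by (cases "D_fn \<beta> lam = 0") (auto simp: S1_def S2_def S3_iff exc_set_def)
  qed
  moreover have "S1 \<inter> S2 = {}" "S1 \<inter> S3 = {}" "S2 \<inter> S3 = {}"
    by (auto simp: S1_def S2_def S3_iff exc_set_def)
  moreover have "mult_L N \<alpha> \<beta> lam
      = mult_L (N-1) (alpha_down \<alpha> \<beta> lam) (beta_down \<alpha> \<beta> lam) (R_fn \<alpha> \<beta> lam)"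
    if "lam \<in> S1" for lam
    using that regular(1)[of lam] by (simp add: S1_def N)
  ultimately show ?thesis using mult by blast
qed

end
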